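(* Fix $n\in\mathbb{N}$ and a parity (odd or even). For $[\mathfrak{a}]\in\mathcal{C}_K$ let $h_{[\mathfrak{a}]}$ denote the number of isometry classes of positive definite unimodular hermitian lattices over $K$ of rank $n$, of the fixed parity, with Steinitz class $[\mathfrak{a}]$. Then: (a) If $\gcd(n,h_K)=1$, then $h_{[\mathfrak{a}]}=h_{[\mathfrak{b}]}$ for all $[\mathfrak{a}],[\mathfrak{b}]\in\mathcal{C}_K$. (b) If $\gcd(n,\exp(\mathcal{C}_K))\le 2$, then $h_{[\mathfrak{a}]}=h_{[\mathfrak{b}]}$ for all $[\mathfrak{a}]\in\mathcal{C}_K$ and all $[\mathfrak{b}]$ in the ideal genus of $[\mathfrak{a}]$.
   Context: $K$ is an imaginary-quadratic field with ring of integers $\mathfrak{o}$, class group $\mathcal{C}_K$ of order $h_K$ and exponent $\exp(\mathcal{C}_K)$. A hermitian lattice is a finitely generated $\mathfrak{o}$-submodule $L$ of a hermitian space $(V,h)$ with $KL=V$; written $L=\mathfrak{a}_1x_1+\dots+\mathfrak{a}_nx_n$, its Steinitz class is $[\mathfrak{a}_1\cdots\mathfrak{a}_n]$. Unimodular: $L=\{x:h(x,L)\subseteq\mathfrak{o}\}$; even if all $h(x,x)$ generate an ideal in $2\mathfrak{o}$, odd otherwise. Two lattices (possibly on different hermitian spaces) are isometric if some isometry of the ambient spaces maps one onto the other. The lattices counted by $h_{[\mathfrak{a}]}$ form a single partial genus (all lattices of one genus with Steinitz class $[\mathfrak{a}]$), so $h_{[\mathfrak{a}]}$ is its partial class number.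 $[\mathfrak{a}],[\mathfrak{b}]$ lie in the same ideal genus if $[\mathfrak{a}][\mathfrak{b}]^{-1}\in\mathcal{C}_K^2$. *)

theory Defs
  imports "HOL-Computational_Algebra.Polynomial" "HOL-Analysis.Cartesian_Space"
    "HOL-Algebra.Coset" "HOL-Algebra.FiniteProduct"
begin

section \<open>Imaginary quadratic fields\<close>

text \<open>The field \<open>K\<close> is a type \<open>'k\<close> with \<open>K = \<rat>(\<surd>d)\<close> for a negative integer \<open>d\<close>.\<close>

definition imaginary_quadratic_field :: "'k::field_char_0 itself \<Rightarrow> bool" where
  "imaginary_quadratic_field _ \<longleftrightarrow>
     (\<exists>(d::int) (w::'k). d < 0 \<and> w\<^sup>2 = of_int d \<and>
        (\<forall>x. \<exists>(a::rat) (b::rat). x = of_rat a + of_rat b * w))"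

definition field_automorphism :: "('k::field \<Rightarrow> 'k) \<Rightarrow> bool" where
  "field_automorphism \<sigma> \<longleftrightarrow>
     bij \<sigma> \<and> (\<forall>x y. \<sigma> (x + y) = \<sigma> x + \<sigma> y) \<and> (\<forall>x y. \<sigma> (x * y) = \<sigma> x * \<sigma> y)"

text \<open>Complex conjugation on \<open>K\<close>: a quadratic field has exactly one nontrivial automorphism.\<close>

definition conjugation :: "'k::field \<Rightarrow> 'k" where
  "conjugation = (THE \<sigma>. field_automorphism \<sigma> \<and> \<sigma> \<noteq> id)"

definition integers_of :: "'k::field set" where
  "integers_of = {x. algebraic_int x}"

text \<open>The \<open>\<oo>\<close>-submodule generated by \<open>X\<close>; it is used with \<open>smul = (*)\<close> on \<open>K\<close> and with
  \<open>smul = (*s)\<close> on \<open>K\<^sup>n\<close>.\<close>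

definition integral_span :: "('k::field \<Rightarrow> 'v \<Rightarrow> 'v) \<Rightarrow> 'v set \<Rightarrow> 'v::ab_group_add set" where
  "integral_span smul X =
     {\<Sum>x\<in>F. smul (c x) x | F c. finite F \<and> F \<subseteq> X \<and> (\<forall>x\<in>F. c x \<in> integers_of)}"


section \<open>The class group\<close>

definition fractional_ideal :: "'k::field set \<Rightarrow> bool" where
  "fractional_ideal I \<longleftrightarrow> I \<noteq> {0} \<and> (\<exists>X. finite X \<and> I = integral_span (*) X)"

definition ideal_product :: "'k::field set \<Rightarrow> 'k set \<Rightarrow> 'k set" where
  "ideal_product I J = integral_span (*) {x * y | x y. x \<in> I \<and> y \<in> J}"

definition ideal_group :: "'k::field set monoid" where
  "ideal_group = \<lparr>carrier = {I. fractional_ideal I}, mult = ideal_product, one = integers_of\<rparr>"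

definition principal_ideals :: "'k::field set set" where
  "principal_ideals = {integral_span (*) {x} | x. x \<noteq> 0}"

definition class_group :: "'k::field set set monoid" where
  "class_group = ideal_group Mod principal_ideals"

definition ideal_class :: "'k::field set \<Rightarrow> 'k set set" where
  "ideal_class I = principal_ideals #>\<^bsub>ideal_group\<^esub> I"

text \<open>By convention the exponent is 0 if there is no positive one (impossible for a class group,
  which is finite).\<close>

definition group_exponent :: "('a, 'b) monoid_scheme \<Rightarrow> nat" where
  "group_exponent G =
     (let P = (\<lambda>e. 0 < e \<and> (\<forall>x\<in>carrier G. x [^]\<^bsub>G\<^esub> e = \<one>\<^bsub>G\<^esub>))
      in if \<exists>e. P e then LEAST e. P e else 0)"

definition same_ideal_genus :: "'k::field set set \<Rightarrow> 'k set set \<Rightarrow> bool" where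
  "same_ideal_genus A B \<longleftrightarrow>
     A \<otimes>\<^bsub>class_group\<^esub> inv\<^bsub>class_group\<^esub> B \<in> {C [^]\<^bsub>class_group\<^esub> (2::nat) | C. C \<in> carrier class_group}"


section \<open>Hermitian lattices\<close>

text \<open>Every hermitian space of dimension \<open>n\<close> over \<open>K\<close> is isometric to one with underlying vector
  space \<open>K\<^sup>n\<close>, so only these are considered, with arbitrary form \<open>h\<close>. A lattice on a hermitian
  space is represented by the pair \<open>(h, L)\<close>, so that the ambient space varies with \<open>h\<close>.\<close>

type_synonym ('k, 'n) form = "'k^'n \<Rightarrow> 'k^'n \<Rightarrow> 'k"

definition hermitian_form :: "('k::field, 'n::finite) form \<Rightarrow> bool" where
  "hermitian_form h \<longleftrightarrow>
     (\<forall>y. Vector_Spaces.linear (*s) (*) (\<lambda>x. h x y)) \<and> (\<forall>x y. h y x = conjugation (h x y))"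

definition positive_definite :: "('k::field_char_0, 'n::finite) form \<Rightarrow> bool" where
  "positive_definite h \<longleftrightarrow> (\<forall>x. x \<noteq> 0 \<longrightarrow> (\<exists>q::rat. 0 < q \<and> h x x = of_rat q))"

definition lattice_in_space :: "('k::field^'n::finite) set \<Rightarrow> bool" where
  "lattice_in_space L \<longleftrightarrow> (\<exists>X. finite X \<and> L = integral_span (*s) X) \<and> vec.span L = UNIV"

definition unimodular :: "('k::field, 'n::finite) form \<Rightarrow> ('k^'n) set \<Rightarrow> bool" where
  "unimodular h L \<longleftrightarrow> L = {x. \<forall>y\<in>L. h x y \<in> integers_of}"

definition norm_ideal :: "('k::field, 'n::finite) form \<Rightarrow> ('k^'n) set \<Rightarrow> 'k set" where
  "norm_ideal h L = integral_span (*) {h x x | x. x \<in> L}"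

definition even_lattice :: "('k::field, 'n::finite) form \<Rightarrow> ('k^'n) set \<Rightarrow> bool" where
  "even_lattice h L \<longleftrightarrow> norm_ideal h L \<subseteq> {2 * a | a. a \<in> integers_of}"

datatype parity = Even | Odd

fun has_parity :: "parity \<Rightarrow> ('k::field, 'n::finite) form \<Rightarrow> ('k^'n) set \<Rightarrow> bool" where
  "has_parity Even h L \<longleftrightarrow> even_lattice h L"
| "has_parity Odd h L \<longleftrightarrow> \<not> even_lattice h L"

text \<open>\<open>L = \<aa>\<^sub>1 x\<^sub>1 + \<dots> + \<aa>\<^sub>n x\<^sub>n\<close> with a basis \<open>x\<close> of \<open>K\<^sup>n\<close> and fractional ideals \<open>\<aa>\<^sub>i\<close> such that
  \<open>C = [\<aa>\<^sub>1 \<cdots> \<aa>\<^sub>n]\<close>. By Steinitz' theorem every lattice has exactly one such class \<open>C\<close>.\<close>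

definition has_steinitz_class :: "('k::field^'n::finite) set \<Rightarrow> 'k set set \<Rightarrow> bool" where
  "has_steinitz_class L C \<longleftrightarrow>
     (\<exists>(a :: 'n \<Rightarrow> 'k set) (x :: 'n \<Rightarrow> 'k^'n).
        (\<forall>i. fractional_ideal (a i)) \<and>
        inj x \<and> vec.independent (range x) \<and> vec.span (range x) = UNIV \<and>
        L = {\<Sum>i\<in>UNIV. c i *s x i | c. \<forall>i. c i \<in> a i} \<and>
        C = ideal_class (finprod ideal_group a UNIV))"

definition lattice_isometry ::
  "((('k::field, 'n::finite) form \<times> ('k^'n) set) \<times> (('k, 'n) form \<times> ('k^'n) set)) set" where
  "lattice_isometry =
     {((h, L), (h', L')). \<exists>\<sigma>. Vector_Spaces.linear (*s) (*s) \<sigma> \<and> bij \<sigma> \<and>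
        (\<forall>x y. h' (\<sigma> x) (\<sigma> y) = h x y) \<and> \<sigma> ` L = L'}"

definition unimodular_lattices ::
  "parity \<Rightarrow> 'k::field_char_0 set set \<Rightarrow> (('k, 'n::finite) form \<times> ('k^'n) set) set" where
  "unimodular_lattices p C =
     {(h, L). hermitian_form h \<and> positive_definite h \<and> lattice_in_space L \<and>
        unimodular h L \<and> has_parity p h L \<and> has_steinitz_class L C}"

definition partial_class_number ::
  "'n::finite itself \<Rightarrow> parity \<Rightarrow> 'k::field_char_0 set set \<Rightarrow> nat" where
  "partial_class_number _ p C =
     card ((unimodular_lattices p C :: (('k, 'n) form \<times> ('k^'n) set) set) // lattice_isometry)"

end

theory Submission
  imports Defs
begin

text \<open>
  Let \<open>I\<close> be a fractional ideal generated by \<open>x\<^sub>1, \<dots>, x\<^sub>k\<close>, and let \<open>q > 0\<close> generate the subgroup of \<open>\<rat>\<close>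
  spanned by the norms \<open>N(x\<^sub>i)\<close> and the traces \<open>Tr(x\<^sub>i x\<^sub>j\<^sup>*)\<close>, where \<open>*\<close> is conjugation. Then
  \<open>I I\<^sup>* = q \<oo>\<close>: the element \<open>x\<^sub>i x\<^sub>j\<^sup>* / q\<close> has integral trace and its norm \<open>N(x\<^sub>i)/q \<cdot> N(x\<^sub>j)/q\<close> is integral.
  So \<open>I\<close> is invertible, and \<open>(h, L) \<mapsto> (h/q, I L)\<close> maps unimodular lattices of a given parity to such
  lattices, respects isometry, and multiplies the Steinitz class by \<open>[I]\<^sup>n\<close>. Its inverse is the same
  map for \<open>I\<^sup>*/q\<close> and \<open>1/q\<close>. Hence partial class numbers agree for classes that differ
  by an \<open>n\<close>-th power, and Bezout's identity turns both gcd conditions into this.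
\<close>

section \<open>The ring of integers\<close>

lemma map_poly_of_int_add:
  "map_poly of_int (p + q) = (map_poly of_int p + map_poly of_int q :: 'a::field_char_0 poly)"
  by (intro poly_eqI) (simp add: coeff_map_poly)

lemma map_poly_of_int_mult:
  "map_poly of_int (p * q) = (map_poly of_int p * map_poly of_int q :: 'a::field_char_0 poly)"
  by (intro poly_eqI) (simp add: coeff_map_poly coeff_mult)

lemma map_poly_of_int_smult:
  "map_poly of_int (smult c p) = (smult (of_int c) (map_poly of_int p) :: 'a::field_char_0 poly)"
  by (intro poly_eqI) (simp add: coeff_map_poly)

lemmas map_poly_of_int_simps =
  map_poly_of_int_add map_poly_of_int_mult map_poly_of_int_smult map_poly_pCons

text \<open>Gauss' lemma, used after pseudo-division of a monic integral equation of \<open>x\<close> by \<open>q\<close>.\<close>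

lemma lead_coeff_unit_of_root_algebraic_int:
  fixes x :: "'a::field_char_0" and q :: "int poly"
  assumes x: "algebraic_int x" and q: "content q = 1" "poly (map_poly of_int q) x = 0"
    and min: "\<And>r :: int poly. poly (map_poly of_int r) x = 0 \<Longrightarrow> degree r < degree q \<Longrightarrow> r = 0"
  shows "lead_coeff q dvd 1"
proof -
  obtain p :: "int poly" where p: "poly (map_poly of_int p) x = 0" "lead_coeff p = 1"
    using x unfolding algebraic_int_altdef_ipoly by blast
  have q0: "q \<noteq> 0" using q(1) by auto
  define r where "r = pseudo_mod p q"
  obtain a s where as: "a \<noteq> 0" "smult a p = q * s + r"
    using pseudo_mod(1)[OF q0, of p] unfolding r_def by blast
  have "poly (map_poly of_int (q * s + r)) x = (0::'a)"
    unfolding as(2)[symmetric] using p(1) by (simp add: map_poly_of_int_smult)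
  then have "poly (map_poly of_int r) x = (0::'a)"
    using q(2) by (simp add: map_poly_of_int_simps)
  moreover have "r = 0 \<or> degree r < degree q"
    using pseudo_mod(2)[OF q0, of p] by (simp add: r_def)
  ultimately have "r = 0"
    using min by blast
  with as have eq: "smult a p = q * s" by simp
  have "content p dvd lead_coeff p" by (rule content_dvd_coeff)
  then have cp: "content p = 1" unfolding p(2) by (simp flip: is_unit_content_iff)
  \<comment> \<open>Contents are multiplicative. With \<open>q\<close> primitive and
    \<open>p\<close> monic, all of \<open>a\<close> lies in the content of \<open>s\<close>, so it
    cancels and \<open>q\<close> divides \<open>p\<close> over the integers.\<close>
  have "content s = \<bar>a\<bar>"
    using arg_cong[OF eq, of content] q(1) cp by (simp add: content_mult)
  then have "[:a:] dvd s"
    by (simp add: const_poly_dvd_iff_dvd_content)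
  then obtain s' where "s = smult a s'"
    by (auto elim: dvdE)
  with eq have "smult a (p - q * s') = 0"
    by (simp add: smult_diff_right)
  with as(1) have "p = q * s'"
    by simp
  then have "lead_coeff q * lead_coeff s' = 1"
    using p(2) by (simp add: lead_coeff_mult)
  then show ?thesis by (metis dvd_triv_left)
qed

text \<open>Clear denominators and pass to the primitive part \<open>q\<close>. As \<open>x\<close>
  is irrational, no nonzero integral polynomial of smaller degree vanishes at \<open>x\<close>, so
  \<open>q\<close> has leading coefficient 1 or -1; \<open>t\<close> and \<open>n\<close> are, up to
  sign, quotients of its coefficients by this one.\<close>

lemma algebraic_int_quadratic:
  fixes x :: "'a::field_char_0"
  assumes x: "algebraic_int x" "x \<notin> \<rat>"
    and t: "t \<in> \<rat>" and n: "n \<in> \<rat>" and root: "x\<^sup>2 - t * x + n = 0"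
  shows "t \<in> \<int>" "n \<in> \<int>"
proof -
  obtain t1 t2 where t12: "t2 > 0" "t = of_int t1 / of_int t2"
    using t by (auto elim!: Rats_cases')
  obtain n1 n2 where n12: "n2 > 0" "n = of_int n1 / of_int n2"
    using n by (auto elim!: Rats_cases')
  \<comment> \<open>The equation of \<open>x\<close> multiplied by the common denominator
    \<open>t2 * n2\<close>.\<close>
  define p where "p = [: n1 * t2, - (t1 * n2), t2 * n2 :]"
  define q where "q = primitive_part p"
  have p0: "p \<noteq> 0" and degp: "degree p = 2"
    using t12 n12 by (auto simp: p_def)
  have pq: "p = smult (content p) q"
    by (simp add: q_def)
  have tn: "of_int t1 = t * of_int t2" "of_int n1 = n * of_int n2"
    using t12 n12 by (auto simp: field_simps)
  have "poly (map_poly of_int p) x = of_int t2 * of_int n2 * (x\<^sup>2 - t * x + n)"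
    using tn by (simp add: p_def map_poly_pCons algebra_simps power2_eq_square)
  then have "poly (map_poly of_int p) x = 0"
    using root by simp
  then have rootq: "poly (map_poly of_int q) x = 0"
    using p0 by (subst (asm) pq) (simp add: map_poly_of_int_smult)
  have cq: "content q = 1"
    using p0 by (simp add: q_def)
  have degq: "degree q = 2"
    using degp by (simp add: q_def)
  \<comment> \<open>A nonzero polynomial of degree at most 1 with root \<open>x\<close> would make
    \<open>x\<close> rational.\<close>
  have min: "r = 0" if root: "poly (map_poly of_int r) x = 0" and deg: "degree r < 2" for r :: "int poly"
  proof -
    define u v where "u = coeff r 0" and "v = coeff r 1"
    have "coeff r n = 0" if "n \<ge> 2" for n
      using deg that by (simp add: coeff_eq_0)
    then have r: "r = [:u, v:]"
      by (intro poly_eqI) (auto simp: u_def v_def coeff_pCons numeral_2_eq_2 split: nat.split)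
    then have eq: "of_int u + x * of_int v = 0"
      using root by (simp add: map_poly_pCons)
    have "v = 0"
    proof (rule ccontr)
      assume "v \<noteq> 0"
      then have "x = - of_int u / of_int v"
        using eq by (simp add: field_simps eq_neg_iff_add_eq_0)
      then show False using x(2) by (auto intro: Rats_divide)
    qed
    with eq r show ?thesis by simp
  qed
  have "lead_coeff q dvd 1"
    using x(1) cq rootq min degq by (intro lead_coeff_unit_of_root_algebraic_int) auto
  then have lc: "coeff q 2 = 1 \<or> coeff q 2 = - 1"
    using degq by auto
  have "coeff p 1 = content p * coeff q 1" "coeff p 2 = content p * coeff q 2" "coeff p 0 = content p * coeff q 0"
    by (subst pq, simp)+
  then have p': "t1 * n2 = - content p * coeff q 1" "t2 * n2 = content p * coeff q 2" "n1 * t2 = content p * coeff q 0"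
    by (auto simp: p_def numeral_2_eq_2)
  have "t = of_int (t1 * n2) / of_int (t2 * n2)" "n = of_int (n1 * t2) / of_int (t2 * n2)"
    using t12 n12 by auto
  then have "t = of_int (- coeff q 1) / of_int (coeff q 2)" "n = of_int (coeff q 0) / of_int (coeff q 2)"
    unfolding p' using p0 by auto
  then show "t \<in> \<int>" "n \<in> \<int>"
    using lc by auto
qed

text \<open>This evaluates the description in \<open>conjugation\<close>: an automorphism fixes the
  rationals, hence is determined by the image of \<open>w\<close>. That image is a square root of
  \<open>d\<close>, so it is \<open>w\<close>, which gives the identity, or
  \<open>- w\<close>.\<close>

lemma conjugation_eqI:
  fixes s :: "'k::field_char_0 \<Rightarrow> 'k"
  assumes d: "d < 0" "w\<^sup>2 = of_int d" and gen: "\<And>x. \<exists>a b. x = of_rat a + of_rat b * w"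
    and s: "field_automorphism s" "s w = - w"
  shows "conjugation = s"
proof -
  have aut: "s' (of_rat a + of_rat b * w) = of_rat a + of_rat b * s' w"
    if s': "field_automorphism s'" for s' :: "'k \<Rightarrow> 'k" and a b
  proof -
    have add: "s' (x + y) = s' x + s' y" and mult: "s' (x * y) = s' x * s' y" for x y
      using s' by (auto simp: field_automorphism_def)
    interpret additive s' by unfold_locales (rule add)
    \<comment> \<open>\<open>field_automorphism\<close> does not mention 1, so that 1 is fixed
      follows from \<open>1 * 1 = 1\<close> and injectivity.\<close>
    have "s' 1 \<noteq> 0"
      using s' zero by (metis bij_is_inj field_automorphism_def injD zero_neq_one)
    then have one: "s' 1 = 1"
      using mult[of 1 1] by simp
    have nat: "s' (of_nat n) = of_nat n" for n
      by (induction n) (auto simp: add one zero)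
    have int: "s' (of_int i) = of_int i" for i
      by (cases i) (auto simp: nat minus diff one add)
    have "s' (of_rat q) = of_rat q" for q
    proof (cases q)
      case (Fract i j)
      have "s' (of_rat q) * of_int j = s' (of_rat q * of_int j)"
        by (simp add: mult int)
      also have "of_rat q * of_int j = (of_int i :: 'k)"
        using Fract by (simp add: of_rat_rat)
      finally show ?thesis
        using Fract by (simp add: of_rat_rat int field_simps)
    qed
    then show ?thesis
      by (simp add: add mult)
  qed
  have w0: "w \<noteq> 0"
    using d by auto
  show ?thesis unfolding conjugation_def
  proof (rule the_equality)
    have "s \<noteq> id"
    proof
      assume "s = id"
      then have "2 * w = 0" using s(2) by (simp add: eq_neg_iff_add_eq_0)
      with w0 show False by simp
    qed
    then show "field_automorphism s \<and> s \<noteq> id"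
      using s by simp
  next
    fix s' :: "'k \<Rightarrow> 'k" assume s': "field_automorphism s' \<and> s' \<noteq> id"
    have "(s' w)\<^sup>2 = s' (w\<^sup>2)"
      using s' by (simp add: field_automorphism_def power2_eq_square)
    \<comment> \<open>Written in coordinates, so that \<open>aut\<close> applies.\<close>
    also have "w\<^sup>2 = of_rat (of_int d) + of_rat 0 * w"
      using d(2) by simp
    also have "s' \<dots> = of_rat (of_int d) + of_rat 0 * s' w"
      using s' by (intro aut) auto
    also have "\<dots> = w\<^sup>2"
      using d(2) by simp
    finally have "s' w = w \<or> s' w = - w"
      by (simp add: power2_eq_iff)
    moreover have "s' w \<noteq> w"
    proof
      assume "s' w = w"
      then have "s' x = x" for x
        using gen[of x] s' aut by metis
      with s' show False by (auto simp: fun_eq_iff)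
    qed
    ultimately have "s' w = s w"
      using s by simp
    then have "s' x = s x" for x
      using gen[of x] s' s(1) aut by metis
    then show "s' = s" ..
  qed
qed

section \<open>Conjugation, trace and norm, and the ring structure of the integers\<close>

locale imaginary_quadratic =
  fixes ty :: "'k::field_char_0 itself"
  assumes imaginary_quadratic: "imaginary_quadratic_field TYPE('k)"
begin

abbreviation cnj :: "'k \<Rightarrow> 'k" where "cnj \<equiv> conjugation"
abbreviation oo :: "'k set" where "oo \<equiv> integers_of"

text \<open>All claims are read off in the basis \<open>1, w\<close>, where conjugation negates the
  second coordinate. The sign of \<open>d\<close> enters twice: it makes the coordinates unique, and
  it makes the norm \<open>a\<^sup>2 - b\<^sup>2 * d\<close> positive.\<close>

lemma conjugation_properties:
  "cnj (x + y) = cnj x + cnj y" "cnj (x * y) = cnj x * cnj y" "cnj (of_rat q) = of_rat q"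
  "cnj (cnj x) = x" "x + cnj x \<in> \<rat>" "x \<in> \<rat> \<longleftrightarrow> cnj x = x"
  "x \<noteq> 0 \<Longrightarrow> \<exists>q>0. x * cnj x = of_rat q"
proof -
  obtain d :: int and w :: 'k where d: "d < 0" "w\<^sup>2 = of_int d"
    and gen: "\<exists>a b. x = of_rat a + of_rat b * w" for x
    using imaginary_quadratic unfolding imaginary_quadratic_field_def by metis
  have ww: "w * w = of_rat (of_int d)"
    using d(2) by (simp add: power2_eq_square)
  have zero: "a = 0 \<and> b = 0" if "of_rat a + of_rat b * w = 0" for a b
  proof -
    have "of_rat a = - (of_rat b * w)"
      using that by (simp add: eq_neg_iff_add_eq_0)
    then have "(of_rat a)\<^sup>2 = (of_rat b)\<^sup>2 * w\<^sup>2"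
      by (simp add: power_mult_distrib)
    then have "of_rat (a\<^sup>2) = (of_rat (b\<^sup>2 * of_int d) :: 'k)"
      by (simp add: d(2) of_rat_mult of_rat_power)
    then have eq: "a\<^sup>2 = b\<^sup>2 * of_int d"
      by (simp only: of_rat_eq_iff)
    have "b\<^sup>2 * of_int d \<le> 0"
      using d(1) by (simp add: mult_nonneg_nonpos)
    with eq have "a\<^sup>2 = 0"
      using zero_le_power2[of a] by linarith
    with eq d(1) show ?thesis by simp
  qed
  have uniq: "a = a' \<and> b = b'" if "of_rat a + of_rat b * w = of_rat a' + of_rat b' * w" for a b a' b'
    using zero[of "a - a'" "b - b'"] that by (simp add: of_rat_diff algebra_simps)
  \<comment> \<open>The description is well-defined by \<open>uniq\<close>.\<close>
  define s where "s = (\<lambda>x. THE y. \<exists>a b. x = of_rat a + of_rat b * w \<and> y = of_rat a - of_rat b * w)"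
  have s: "s (of_rat a + of_rat b * w) = of_rat a - of_rat b * w" for a b
    unfolding s_def by (rule the_equality) (auto dest!: uniq)
  have sa: "s (x + y) = s x + s y" for x y
  proof -
    obtain a b a' b' where xy: "x = of_rat a + of_rat b * w" "y = of_rat a' + of_rat b' * w"
      using gen by metis
    have "x + y = of_rat (a + a') + of_rat (b + b') * w"
      by (simp add: xy of_rat_add algebra_simps)
    then show ?thesis
      by (simp only: s xy) (simp add: of_rat_add algebra_simps)
  qed
  have sm: "s (x * y) = s x * s y" for x y
  proof -
    obtain a b a' b' where xy: "x = of_rat a + of_rat b * w" "y = of_rat a' + of_rat b' * w"
      using gen by metis
    have "x * y = of_rat (a * a' + b * b' * of_int d) + of_rat (a * b' + b * a') * w"
      using ww by (simp add: xy of_rat_add of_rat_mult algebra_simps)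
    moreover have "s x * s y = of_rat (a * a' + b * b' * of_int d) - of_rat (a * b' + b * a') * w"
      unfolding xy s using ww by (simp add: of_rat_add of_rat_mult algebra_simps)
    ultimately show ?thesis
      by (simp only: s)
  qed
  have ss: "s (s x) = x" for x
  proof -
    obtain a b where x: "x = of_rat a + of_rat b * w"
      using gen by metis
    have "s x = of_rat a + of_rat (- b) * w"
      unfolding x s by (simp add: of_rat_minus)
    then show ?thesis
      by (simp only: s) (simp add: x of_rat_minus)
  qed
  have "bij s"
    by (rule o_bij[of s]) (auto simp: ss fun_eq_iff)
  moreover have sw: "s w = - w"
    using s[of 0 1] by simp
  ultimately have cnj: "cnj = s"
    using d gen sa sm by (intro conjugation_eqI) (auto simp: field_automorphism_def)
  show "cnj (x + y) = cnj x + cnj y" "cnj (x * y) = cnj x * cnj y" "cnj (cnj x) = x"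
    by (auto simp: cnj sa sm ss)
  have sq: "s (of_rat q) = of_rat q" for q
    using s[of q 0] by simp
  then show "cnj (of_rat q) = of_rat q"
    by (simp add: cnj)
  obtain a b where x: "x = of_rat a + of_rat b * w"
    using gen by metis
  have "x + cnj x = of_rat (2 * a)"
    by (simp add: cnj s x of_rat_mult)
  then show "x + cnj x \<in> \<rat>" by simp
  show "x \<in> \<rat> \<longleftrightarrow> cnj x = x"
  proof
    assume "cnj x = x"
    then have "b = - b"
      using uniq[of a "-b" a b] by (auto simp: cnj s x of_rat_minus)
    then show "x \<in> \<rat>" by (simp add: x)
  qed (auto simp: cnj sq elim!: Rats_cases)
  assume "x \<noteq> 0"
  have "x * cnj x = of_rat (a\<^sup>2 - b\<^sup>2 * of_int d)"
    unfolding cnj x s using ww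
    by (simp add: of_rat_diff of_rat_mult of_rat_power algebra_simps power2_eq_square)
  moreover have "a\<^sup>2 - b\<^sup>2 * of_int d > 0"
  proof -
    have "b\<^sup>2 * of_int d \<le> 0"
      using d(1) by (simp add: mult_nonneg_nonpos)
    moreover have "a\<^sup>2 > 0 \<or> b\<^sup>2 * of_int d < 0"
      using \<open>x \<noteq> 0\<close> d(1) by (auto simp: x mult_less_0_iff)
    ultimately show ?thesis
      using zero_le_power2[of a] by linarith
  qed
  ultimately show "\<exists>q>0. x * cnj x = of_rat q" by blast
qed

lemmas conj_add = conjugation_properties(1)
lemmas conj_mult = conjugation_properties(2)
lemmas conj_of_rat = conjugation_properties(3)
lemmas conj_conj [simp] = conjugation_properties(4)
lemmas trace_rat = conjugation_properties(5)
lemmas rat_iff_conj = conjugation_properties(6)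
lemmas norm_pos = conjugation_properties(7)

sublocale conj: additive cnj
  by unfold_locales (rule conj_add)

lemma norm_rat: "x * cnj x \<in> \<rat>"
  by (simp add: rat_iff_conj conj_mult mult.commute)

text \<open>Every \<open>x\<close> is a root of the polynomial with its trace and norm as
  coefficients, which gives one direction. For the other, an irrational \<open>x\<close> is covered
  by \<open>algebraic_int_quadratic\<close>, and a rational one is an integer equal to its
  conjugate.\<close>

lemma integers_of_iff: "x \<in> oo \<longleftrightarrow> x + cnj x \<in> \<int> \<and> x * cnj x \<in> \<int>"
proof
  assume x: "x \<in> oo"
  show "x + cnj x \<in> \<int> \<and> x * cnj x \<in> \<int>"
  proof (cases "x \<in> \<rat>")
    case True
    then have "x \<in> \<int>"
      using x by (auto simp: integers_of_def intro: rational_algebraic_int_is_int)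
    moreover have "cnj x = x"
      using True by (simp add: rat_iff_conj)
    ultimately show ?thesis by auto
  next
    case False
    have "x\<^sup>2 - (x + cnj x) * x + x * cnj x = 0"
      by (simp add: algebra_simps power2_eq_square)
    then show ?thesis
      using algebraic_int_quadratic[of x "x + cnj x" "x * cnj x"] x False trace_rat norm_rat
      by (auto simp: integers_of_def)
  qed
next
  assume *: "x + cnj x \<in> \<int> \<and> x * cnj x \<in> \<int>"
  show "x \<in> oo" unfolding integers_of_def mem_Collect_eq
  proof
    show "lead_coeff [:x * cnj x, - (x + cnj x), 1:] = 1" by simp
    show "\<forall>i. coeff [:x * cnj x, - (x + cnj x), 1:] i \<in> \<int>"
      using * by (auto simp: coeff_pCons split: nat.split simp del: minus_add_distrib)
    show "poly [:x * cnj x, - (x + cnj x), 1:] x = 0"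
      by (simp add: algebra_simps)
  qed
qed

text \<open>With \<open>u = Tr(x y\<^sup>*)\<close> and \<open>v = Tr(x y)\<close>, both \<open>u + v = Tr(x) Tr(y)\<close> and \<open>m = u v\<close> are integers, so the
  rational number \<open>u\<close> is integral.\<close>

lemma trace_mult_int:
  assumes "x \<in> oo" "y \<in> oo"
  shows "x * cnj y + cnj x * y \<in> \<int>"
proof (rule rational_algebraic_int_is_int)
  \<comment> \<open>The product \<open>u v\<close> in terms of traces and norms, from
    \<open>x\<^sup>2 + (cnj x)\<^sup>2 = (x + cnj x)\<^sup>2 - 2 * x * cnj x\<close> and the same
    for \<open>y\<close>.\<close>
  define m where "m = (y * cnj y) * (x + cnj x)\<^sup>2 + (x * cnj x) * (y + cnj y)\<^sup>2
    - 4 * (x * cnj x) * (y * cnj y)"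
  have xy: "x + cnj x \<in> \<int>" "x * cnj x \<in> \<int>" "y + cnj y \<in> \<int>" "y * cnj y \<in> \<int>"
    using assms by (auto simp: integers_of_iff)
  show "algebraic_int (x * cnj y + cnj x * y)"
  proof
    let ?p = "[:m, - ((x + cnj x) * (y + cnj y)), 1:]"
    show "lead_coeff ?p = 1" by simp
    have "m \<in> \<int>" "- ((x + cnj x) * (y + cnj y)) \<in> \<int>"
      unfolding m_def using xy by (auto intro!: Ints_add Ints_diff Ints_mult Ints_power Ints_minus simp del: minus_add_distrib)
    then show "\<forall>i. coeff ?p i \<in> \<int>"
      by (auto simp del: minus_mult_left simp: coeff_pCons split: nat.split)
    show "poly ?p (x * cnj y + cnj x * y) = 0"
      by (simp add: m_def algebra_simps power2_eq_square)
  qed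
  show "x * cnj y + cnj x * y \<in> \<rat>"
    by (simp add: rat_iff_conj conj_add conj_mult add.commute)
qed

lemma conj_int: "x \<in> oo \<Longrightarrow> cnj x \<in> oo"
  by (simp add: integers_of_iff add.commute mult.commute)

lemma int_mult: assumes "x \<in> oo" "y \<in> oo" shows "x * y \<in> oo"
proof -
  \<comment> \<open>With \<open>cnj y\<close> in place of \<open>y\<close>, the integer of
    \<open>trace_mult_int\<close> is the trace of \<open>x * y\<close>.\<close>
  have "x * cnj (cnj y) + cnj x * cnj y \<in> \<int>"
    using assms by (intro trace_mult_int conj_int)
  moreover have "(x * cnj x) * (y * cnj y) \<in> \<int>"
    using assms by (auto simp: integers_of_iff)
  ultimately show ?thesis
    by (simp add: integers_of_iff conj_mult mult_ac)
qed

lemma int_add: assumes "x \<in> oo" "y \<in> oo" shows "x + y \<in> oo"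
proof -
  \<comment> \<open>The second sum is the norm of \<open>x + y\<close>.\<close>
  have "(x + cnj x) + (y + cnj y) \<in> \<int>" "x * cnj x + y * cnj y + (x * cnj y + cnj x * y) \<in> \<int>"
    using assms trace_mult_int[OF assms] by (auto simp: integers_of_iff)
  then show ?thesis
    by (simp add: integers_of_iff conj_add algebra_simps)
qed

lemma Ints_int: "x \<in> \<int> \<Longrightarrow> x \<in> oo"
  by (auto simp: integers_of_def intro: int_imp_algebraic_int)

lemma zero_int [simp]: "0 \<in> oo" and one_int [simp]: "1 \<in> oo"
  by (simp_all add: Ints_int)

end


section \<open>Modules and fractional ideals\<close>

text \<open>One locale treats ideals in \<open>K\<close> and lattices in the vector space over
  \<open>K\<close> alike; it is interpreted for both.\<close>

locale integral_module = imaginary_quadratic ty + vector_space smul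
  for ty :: "'k::field_char_0 itself" and smul :: "'k \<Rightarrow> 'v::ab_group_add \<Rightarrow> 'v"
begin

definition submod :: "'v set \<Rightarrow> bool" where
  "submod M \<longleftrightarrow> 0 \<in> M \<and> (\<forall>x\<in>M. \<forall>y\<in>M. x + y \<in> M) \<and> (\<forall>a\<in>oo. \<forall>x\<in>M. smul a x \<in> M)"

abbreviation ospan :: "'v set \<Rightarrow> 'v set" where
  "ospan \<equiv> integral_span smul"

definition prd :: "'k set \<Rightarrow> 'v set \<Rightarrow> 'v set" where
  "prd I M = ospan {smul x y | x y. x \<in> I \<and> y \<in> M}"

lemma submod_zero: "submod M \<Longrightarrow> 0 \<in> M"
  and submod_add: "submod M \<Longrightarrow> x \<in> M \<Longrightarrow> y \<in> M \<Longrightarrow> x + y \<in> M"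
  and submod_smul: "submod M \<Longrightarrow> a \<in> oo \<Longrightarrow> x \<in> M \<Longrightarrow> smul a x \<in> M"
  by (auto simp: submod_def)

lemma submod_sum: "submod M \<Longrightarrow> (\<And>i. i \<in> F \<Longrightarrow> f i \<in> M) \<Longrightarrow> sum f F \<in> M"
  by (induction F rule: infinite_finite_induct) (auto intro: submod_zero submod_add)

lemma ospan_minimal: "submod M \<Longrightarrow> X \<subseteq> M \<Longrightarrow> ospan X \<subseteq> M"
  unfolding integral_span_def by (auto intro!: submod_sum submod_smul)

lemma ospan_superset: "x \<in> X \<Longrightarrow> x \<in> ospan X"
  unfolding integral_span_def
  by (rule CollectI, rule exI[of _ "{x}"], rule exI[of _ "\<lambda>_. 1"]) auto

lemma submod_ospan: "submod (ospan X)"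
  unfolding submod_def
proof (intro conjI ballI)
  show "0 \<in> ospan X"
    unfolding integral_span_def by (rule CollectI, rule exI[of _ "{}"]) auto
next
  fix x y assume "x \<in> ospan X" "y \<in> ospan X"
  then obtain F c G b where F: "finite F" "F \<subseteq> X" "\<forall>x\<in>F. c x \<in> oo" "x = (\<Sum>x\<in>F. smul (c x) x)"
    and G: "finite G" "G \<subseteq> X" "\<forall>x\<in>G. b x \<in> oo" "y = (\<Sum>x\<in>G. smul (b x) x)"
    unfolding integral_span_def by blast
  \<comment> \<open>Both coefficient families are extended by zero to the common index set
    \<open>F \<union> G\<close>.\<close>
  define c' b' where "c' x = (if x \<in> F then c x else 0)" and "b' x = (if x \<in> G then b x else 0)" for x
  have "x = (\<Sum>x\<in>F \<union> G. smul (c' x) x)"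
    unfolding F(4) using F(1) G(1) by (intro sum.mono_neutral_cong_left) (auto simp: c'_def)
  moreover have "y = (\<Sum>x\<in>F \<union> G. smul (b' x) x)"
    unfolding G(4) using F(1) G(1) by (intro sum.mono_neutral_cong_left) (auto simp: b'_def)
  ultimately have "x + y = (\<Sum>x\<in>F \<union> G. smul (c' x + b' x) x)"
    by (simp add: sum.distrib scale_left_distrib)
  moreover have "\<forall>x\<in>F \<union> G. c' x + b' x \<in> oo"
    using F(3) G(3) by (auto simp: c'_def b'_def intro: int_add)
  ultimately show "x + y \<in> ospan X"
    using F(1,2) G(1,2) unfolding integral_span_def
    by (intro CollectI exI[of _ "F \<union> G"] exI[of _ "\<lambda>x. c' x + b' x"]) auto
next
  fix a x assume a: "a \<in> oo" and "x \<in> ospan X"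
  then obtain F c where F: "finite F" "F \<subseteq> X" "\<forall>x\<in>F. c x \<in> oo" "x = (\<Sum>x\<in>F. smul (c x) x)"
    unfolding integral_span_def by blast
  then have "smul a x = (\<Sum>x\<in>F. smul (a * c x) x)"
    by (simp add: scale_sum_right)
  with F a show "smul a x \<in> ospan X"
    unfolding integral_span_def
    by (intro CollectI exI[of _ F] exI[of _ "\<lambda>x. a * c x"]) (auto intro: int_mult)
qed

lemma submod_prd: "submod (prd I M)"
  by (simp add: prd_def submod_ospan)

lemma prdI: "x \<in> I \<Longrightarrow> y \<in> M \<Longrightarrow> smul x y \<in> prd I M"
  unfolding prd_def by (rule ospan_superset) blast

text \<open>Inclusions between products are checked on generators: the target \<open>P\<close> is
  taken as a preimage of a submodule, by the preimage lemmas below.\<close>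

lemma prd_least: "submod P \<Longrightarrow> (\<And>x y. x \<in> I \<Longrightarrow> y \<in> M \<Longrightarrow> smul x y \<in> P) \<Longrightarrow> prd I M \<subseteq> P"
  unfolding prd_def by (rule ospan_minimal) auto

lemma prd_one: "submod M \<Longrightarrow> prd oo M = M"
proof (intro equalityI prd_least subsetI)
  fix x assume "x \<in> M"
  then show "x \<in> prd oo M"
    using prdI[of 1 oo x M] by simp
qed (auto intro: submod_smul)

lemma submod_preimage:
  assumes "submod M" "f 0 = 0" "\<And>x y. f (x + y) = f x + f y" "\<And>a x. a \<in> oo \<Longrightarrow> f (smul a x) = smul a (f x)"
  shows "submod {x. f x \<in> M}"
  using assms by (auto simp: submod_def)

lemma submod_smul_preimage: "submod M \<Longrightarrow> submod {x. smul a x \<in> M}"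
  by (rule submod_preimage) (auto simp: scale_right_distrib mult.commute)

end

sublocale imaginary_quadratic \<subseteq> K: integral_module ty "(*) :: 'k \<Rightarrow> 'k \<Rightarrow> 'k"
  by unfold_locales

text \<open>For multiplication in \<open>K\<close> this rule reads
  \<open>a * (b * x) = a * b * x\<close>, against the direction of
  \<open>mult.assoc\<close>.\<close>

declare (in imaginary_quadratic) K.scale_scale [simp del]

context integral_module
begin

lemma submod_coeff_preimage: "submod M \<Longrightarrow> K.submod {x. smul x y \<in> M}"
  by (auto simp: submod_def K.submod_def scale_left_distrib simp flip: scale_scale)

text \<open>For each inclusion one factor is held fixed, and the elements of the inner product that
  it sends into the target form a submodule containing the generators.\<close>

lemma prd_assoc: "prd (K.prd I J) M = prd I (prd J M)"
proof
  show "prd (K.prd I J) M \<subseteq> prd I (prd J M)"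
  proof (rule prd_least[OF submod_prd])
    fix x y assume x: "x \<in> K.prd I J" and y: "y \<in> M"
    have "K.prd I J \<subseteq> {x. smul x y \<in> prd I (prd J M)}"
      using y by (intro K.prd_least submod_coeff_preimage submod_prd)
        (auto simp flip: scale_scale intro: prdI)
    with x show "smul x y \<in> prd I (prd J M)" by blast
  qed
  show "prd I (prd J M) \<subseteq> prd (K.prd I J) M"
  proof (rule prd_least[OF submod_prd])
    fix x v assume x: "x \<in> I" and v: "v \<in> prd J M"
    have "prd J M \<subseteq> {v. smul x v \<in> prd (K.prd I J) M}"
      using x by (intro prd_least submod_smul_preimage submod_prd)
        (auto intro!: prdI K.prdI)
    with v show "smul x v \<in> prd (K.prd I J) M" by blast
  qed
qed

lemma prd_ospan: "prd (K.ospan X) (ospan Y) = ospan {smul x y | x y. x \<in> X \<and> y \<in> Y}" (is "_ = ?S")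
proof
  show "prd (K.ospan X) (ospan Y) \<subseteq> ?S"
  proof (rule prd_least[OF submod_ospan])
    fix x y assume x: "x \<in> K.ospan X" and y: "y \<in> ospan Y"
    have "smul x y \<in> ?S" if "y \<in> Y" for y
    proof -
      have "K.ospan X \<subseteq> {x. smul x y \<in> ?S}"
        using that by (intro K.ospan_minimal submod_coeff_preimage submod_ospan) (auto intro!: ospan_superset)
      with x show ?thesis by blast
    qed
    then have "ospan Y \<subseteq> {y. smul x y \<in> ?S}"
      by (intro ospan_minimal submod_smul_preimage submod_ospan) auto
    with y show "smul x y \<in> ?S" by blast
  qed
  show "?S \<subseteq> prd (K.ospan X) (ospan Y)"
    by (intro ospan_minimal submod_prd) (auto intro!: prdI ospan_superset K.ospan_superset)
qed

lemma prd_finitely_generated: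
  assumes "finite X" "finite Y"
  shows "\<exists>Z. finite Z \<and> prd (K.ospan X) (ospan Y) = ospan Z"
  using assms by (intro exI[of _ "{smul x y | x y. x \<in> X \<and> y \<in> Y}"] conjI prd_ospan finite_image_set2) auto

end

text \<open>The second conjunct says that \<open>q\<close> lies in the subgroup generated by \<open>G\<close>.\<close>

lemma finite_rat_gcd:
  assumes "finite (G :: rat set)"
  shows "\<exists>q. (\<forall>g\<in>G. \<exists>n. g = of_int n * q) \<and>
    (\<forall>M. 0 \<in> M \<longrightarrow> (\<forall>x\<in>M. \<forall>y\<in>M. x + y \<in> M) \<longrightarrow> (\<forall>n. \<forall>x\<in>M. of_int n * x \<in> M) \<longrightarrow> G \<subseteq> M \<longrightarrow> q \<in> M)"
  using assms
proof (induction G rule: finite_induct)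
  case empty
  \<comment> \<open>The gcd of the empty set is 0; a nonzero element of \<open>G\<close> will force
    it to be nonzero.\<close>
  show ?case by (rule exI[of _ 0]) auto
next
  case (insert a G)
  obtain q where q: "\<And>g. g \<in> G \<Longrightarrow> \<exists>n. g = of_int n * q"
    "\<And>M. \<lbrakk>0 \<in> M; \<forall>x\<in>M. \<forall>y\<in>M. x + y \<in> M; \<forall>n. \<forall>x\<in>M. of_int n * x \<in> M; G \<subseteq> M\<rbrakk> \<Longrightarrow> q \<in> M"
    using insert.IH by blast
  obtain a1 a2 where "quotient_of a = (a1, a2)"
    by (cases "quotient_of a")
  then have a: "a = of_int a1 / of_int a2" "a2 > 0"
    by (simp_all add: quotient_of_div quotient_of_denom_pos)
  obtain b1 b2 where "quotient_of q = (b1, b2)"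
    by (cases "quotient_of q")
  then have b: "q = of_int b1 / of_int b2" "b2 > 0"
    by (simp_all add: quotient_of_div quotient_of_denom_pos)
  define g where "g = gcd (a1 * b2) (b1 * a2)"
  obtain u v where uv: "u * (a1 * b2) + v * (b1 * a2) = g"
    using bezout_int unfolding g_def by blast
  \<comment> \<open>Over the common denominator \<open>a2 * b2\<close> the numerators of
    \<open>a\<close> and \<open>q\<close> are \<open>a1 * b2\<close> and \<open>b1 * a2\<close>, and
    \<open>g\<close> is their gcd.\<close>
  define r :: rat where "r = of_int g / of_int (a2 * b2)"
  obtain m where m: "a1 * b2 = g * m"
    unfolding g_def using gcd_dvd1 by blast
  obtain k where k: "b1 * a2 = g * k"
    unfolding g_def using gcd_dvd2 by blast
  have "a = of_int (a1 * b2) / of_int (a2 * b2)"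
    using a b by simp
  then have ar: "a = of_int m * r"
    unfolding m by (simp add: r_def)
  have "q = of_int (b1 * a2) / of_int (a2 * b2)"
    using a b by simp
  then have qr: "q = of_int k * r"
    unfolding k by (simp add: r_def)
  have r: "r = of_int u * a + of_int v * q"
  proof -
    have "of_int a1 = a * of_int a2" "of_int b1 = q * of_int b2"
      using a b by (auto simp: field_simps)
    then show ?thesis
      unfolding r_def uv[symmetric] using a(2) b(2) by (simp add: field_simps)
  qed
  show ?case
  proof (rule exI[of _ r], intro conjI allI impI ballI)
    fix g' assume "g' \<in> insert a G"
    then show "\<exists>n. g' = of_int n * r"
    proof
      assume "g' \<in> G"
      then obtain n where "g' = of_int n * q" using q(1) by blast
      then have "g' = of_int (n * k) * r" by (simp add: qr)
      then show ?thesis by blast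
    qed (use ar in blast)
  next
    fix M :: "rat set"
    assume M: "0 \<in> M" "\<forall>x\<in>M. \<forall>y\<in>M. x + y \<in> M" "\<forall>n. \<forall>x\<in>M. of_int n * x \<in> M" "insert a G \<subseteq> M"
    then have "q \<in> M" by (intro q(2)) auto
    with M show "r \<in> M" by (auto simp: r)
  qed
qed

section \<open>Inverses of fractional ideals, the ideal group and the class group\<close>

context imaginary_quadratic
begin

lemma ideal_product_eq: "ideal_product I J = K.prd I J"
  by (simp add: ideal_product_def K.prd_def)

lemma fractional_ideal_submod: "fractional_ideal I \<Longrightarrow> K.submod I"
  unfolding fractional_ideal_def using K.submod_ospan by blast

lemma fractional_ideal_nonzero:
  fixes I :: "'k set"
  assumes "fractional_ideal I"
  obtains x where "x \<in> I" "x \<noteq> 0"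
  using assms K.submod_zero[OF fractional_ideal_submod[OF assms]]
  unfolding fractional_ideal_def by blast

lemma fractional_ideal_prd:
  assumes "fractional_ideal I" "fractional_ideal J"
  shows "fractional_ideal (K.prd I J)"
proof -
  obtain x y where "x \<in> I" "x \<noteq> 0" "y \<in> J" "y \<noteq> 0"
    using assms fractional_ideal_nonzero by metis
  moreover from this have "x * y \<in> K.prd I J"
    by (intro K.prdI)
  ultimately have "K.prd I J \<noteq> {0}"
    by (metis mult_eq_0_iff singletonD)
  moreover have "\<exists>Z. finite Z \<and> K.prd I J = K.ospan Z"
    using assms K.prd_finitely_generated unfolding fractional_ideal_def by metis
  ultimately show ?thesis
    by (simp add: fractional_ideal_def)
qed

lemma prd_comm: "K.prd I J = K.prd J I"
proof -
  have "{x * y | x y. x \<in> I \<and> y \<in> J} = {x * y | x y. x \<in> J \<and> y \<in> I}"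
    by (auto intro: mult.commute)
  then show ?thesis by (simp add: K.prd_def)
qed

lemma submod_oo: "K.submod oo"
  by (auto simp: K.submod_def intro: int_add int_mult)

lemma oo_eq_ospan: "oo = K.ospan {1}"
proof
  show "oo \<subseteq> K.ospan {1}"
  proof
    fix x assume "x \<in> oo"
    then show "x \<in> K.ospan {1}"
      using K.submod_smul[OF K.submod_ospan, of x 1 "{1}"] K.ospan_superset[of 1 "{1}"] by simp
  qed
  show "K.ospan {1} \<subseteq> oo"
    by (rule K.ospan_minimal[OF submod_oo]) simp
qed

lemma fractional_ideal_principal: "x \<noteq> 0 \<Longrightarrow> fractional_ideal (K.ospan {x})"
  unfolding fractional_ideal_def using K.ospan_superset[of x "{x}"] by blast

lemma fractional_ideal_oo: "fractional_ideal oo"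
  unfolding oo_eq_ospan by (rule fractional_ideal_principal) simp

lemma conj_divide_rat: "cnj (x / of_rat q) = cnj x / of_rat q"
proof -
  have "x / of_rat q = x * of_rat (inverse q)" for x :: 'k
    by (simp add: of_rat_inverse divide_inverse)
  then show ?thesis by (simp only: conj_mult conj_of_rat)
qed

text \<open>The inverse ideal of \<open>I\<close> if \<open>I I\<^sup>* = q \<oo>\<close>.\<close>

definition conj_scaled :: "rat \<Rightarrow> 'k set \<Rightarrow> 'k set" where
  "conj_scaled q I = {cnj a / of_rat q | a. a \<in> I}"

text \<open>Conjugate scaling is an additive bijection that is semilinear for conjugation, and
  conjugation preserves \<open>oo\<close>, so it carries spans to spans.\<close>

lemma conj_scaled_ospan: "q \<noteq> 0 \<Longrightarrow> conj_scaled q (K.ospan X) = K.ospan (conj_scaled q X)"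
proof
  assume q: "q \<noteq> 0"
  let ?f = "\<lambda>a. cnj a / of_rat q"
  have cs: "conj_scaled q I = ?f ` I" for I by (auto simp: conj_scaled_def)
  have ff: "?f a = b \<longleftrightarrow> a = cnj (b * of_rat q)" for a b
  proof -
    have "?f a = b \<longleftrightarrow> cnj a = b * of_rat q"
      using q by (auto simp: field_simps)
    then show ?thesis by (metis conj_conj)
  qed
  have 1: "K.submod {a. ?f a \<in> K.ospan (conj_scaled q X)}"
    using K.submod_ospan[of "conj_scaled q X"] q
    unfolding K.submod_def
    by (auto simp: conj.zero conj_add add_divide_distrib conj_mult)
       (metis conj_int times_divide_eq_right)
  show "conj_scaled q (K.ospan X) \<subseteq> K.ospan (conj_scaled q X)"
    using K.ospan_minimal[OF 1, of X] by (auto simp: cs intro: K.ospan_superset)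
  \<comment> \<open>The map \<open>b \<mapsto> cnj (b * q)\<close> inverts conjugate scaling, so
    this is the image of the span.\<close>
  have 2: "K.submod {b. cnj (b * of_rat q) \<in> K.ospan X}"
    unfolding K.submod_def
  proof (intro conjI ballI CollectI)
    show "cnj (0 * of_rat q) \<in> K.ospan X"
      by (simp add: conj.zero K.submod_zero K.submod_ospan)
  next
    fix x y assume "x \<in> {b. cnj (b * of_rat q) \<in> K.ospan X}" "y \<in> {b. cnj (b * of_rat q) \<in> K.ospan X}"
    then show "cnj ((x + y) * of_rat q) \<in> K.ospan X"
      by (simp add: distrib_right conj_add K.submod_add K.submod_ospan)
  next
    fix a x assume "a \<in> oo" "x \<in> {b. cnj (b * of_rat q) \<in> K.ospan X}"
    then show "cnj (a * x * of_rat q) \<in> K.ospan X"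
      using K.submod_smul[OF K.submod_ospan, of "cnj a" "cnj (x * of_rat q)"]
      by (simp add: mult.assoc conj_mult[of a] conj_int)
  qed
  have "K.ospan (conj_scaled q X) \<subseteq> {b. cnj (b * of_rat q) \<in> K.ospan X}"
    using q by (intro K.ospan_minimal[OF 2]) (auto simp: conj_scaled_def intro: K.ospan_superset)
  moreover have "b = ?f (cnj (b * of_rat q))" for b
    using ff[of "cnj (b * of_rat q)" b] by simp
  ultimately show "K.ospan (conj_scaled q X) \<subseteq> conj_scaled q (K.ospan X)"
    unfolding cs[of "K.ospan X"] by blast
qed

lemma fractional_ideal_conj_scaled:
  assumes "fractional_ideal I" "q \<noteq> 0"
  shows "fractional_ideal (conj_scaled q I)"
proof -
  obtain X where X: "finite X" "I = K.ospan X"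
    using assms(1) by (auto simp: fractional_ideal_def)
  obtain a where a: "a \<in> I" "a \<noteq> 0"
    using fractional_ideal_nonzero[OF assms(1)] .
  have "cnj a / of_rat q \<noteq> 0"
    using a(2) assms(2) conj.zero by (metis conj_conj divide_eq_0_iff of_rat_eq_0_iff)
  moreover have "cnj a / of_rat q \<in> conj_scaled q I"
    using a(1) by (auto simp: conj_scaled_def)
  ultimately have "conj_scaled q I \<noteq> {0}" by blast
  moreover have "finite (conj_scaled q X)"
    using X(1) by (simp add: conj_scaled_def Setcompr_eq_image)
  ultimately show ?thesis
    unfolding fractional_ideal_def using X(2) conj_scaled_ospan[OF assms(2)] by blast
qed

text \<open>The product lies in \<open>oo\<close> because products of generators are integral. It
  contains 1 because \<open>q\<close>, up to sign, is an integral combination of norms and traces of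
  generators, each of which is \<open>q\<close> times an element of the product.\<close>

lemma ideal_inverse:
  assumes I: "fractional_ideal I"
  shows "\<exists>q>0. K.prd I (conj_scaled q I) = oo"
proof -
  obtain X where X: "finite X" "I = K.ospan X"
    using I by (auto simp: fractional_ideal_def)
  have XI: "X \<subseteq> I"
    using X(2) K.ospan_superset by blast
  obtain x0 where x0: "x0 \<in> X" "x0 \<noteq> 0"
  proof (rule ccontr)
    assume "\<not> thesis"
    then have "X \<subseteq> {0}" using that by blast
    then have "I \<subseteq> {0}"
      unfolding X(2) by (intro K.ospan_minimal) (auto simp: K.submod_def)
    then show False using fractional_ideal_nonzero[OF I] by blast
  qed
  \<comment> \<open>Norms and traces as elements of type \<open>rat\<close>, where
    \<open>finite_rat_gcd\<close> applies.\<close>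
  define N T where "N x = (SOME r. of_rat r = x * cnj x)"
    and "T x y = (SOME r. of_rat r = x * cnj y + y * cnj x)" for x y
  have N: "of_rat (N x) = x * cnj x" for x
  proof -
    obtain r where "x * cnj x = of_rat r"
      using norm_rat[of x] by (rule Rats_cases)
    then show ?thesis
      unfolding N_def by (metis (mono_tags) someI)
  qed
  have T: "of_rat (T x y) = x * cnj y + y * cnj x" for x y
  proof -
    have "x * cnj y + y * cnj x \<in> \<rat>"
      using trace_rat[of "x * cnj y"] by (simp add: conj_mult mult.commute)
    then obtain r where "x * cnj y + y * cnj x = of_rat r"
      by (rule Rats_cases)
    then show ?thesis
      unfolding T_def by (metis (mono_tags) someI)
  qed
  define G where "G = N ` X \<union> (\<lambda>(x, y). T x y) ` (X \<times> X)"
  have "finite G" using X(1) by (simp add: G_def)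
  from finite_rat_gcd[OF this] obtain q0 where q0: "\<And>g. g \<in> G \<Longrightarrow> \<exists>n. g = of_int n * q0"
    "\<And>M. \<lbrakk>0 \<in> M; \<forall>x\<in>M. \<forall>y\<in>M. x + y \<in> M; \<forall>n. \<forall>x\<in>M. of_int n * x \<in> M; G \<subseteq> M\<rbrakk> \<Longrightarrow> q0 \<in> M"
    by blast
  have "N x0 \<in> G" using x0 by (simp add: G_def)
  moreover have "N x0 \<noteq> 0"
  proof
    assume "N x0 = 0"
    then show False using N[of x0] norm_pos[OF x0(2)] by auto
  qed
  ultimately have "q0 \<noteq> 0" using q0(1) by fastforce
  \<comment> \<open>\<open>finite_rat_gcd\<close> leaves the sign open; a positive scaling factor
    keeps forms positive definite.\<close>
  define q where "q = \<bar>q0\<bar>"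
  have q: "q > 0" using \<open>q0 \<noteq> 0\<close> by (simp add: q_def)
  let ?J = "conj_scaled q I"
  have qG: "of_rat g / of_rat q \<in> (\<int> :: 'k set)" if g: "g \<in> G" for g
  proof -
    obtain n where "g = of_int n * q0" using q0(1)[OF g] by blast
    then have "g / q = of_int n \<or> g / q = of_int (- n)"
      using \<open>q0 \<noteq> 0\<close> by (auto simp: q_def abs_if)
    then have "of_rat (g / q) \<in> (\<int> :: 'k set)"
      by (metis Ints_of_int of_rat_of_int_eq)
    then show ?thesis by (simp add: of_rat_divide)
  qed
  have XX: "x * cnj y / of_rat q \<in> oo" if "x \<in> X" "y \<in> X" for x y
  proof -
    have "of_rat (T x y) / of_rat q \<in> (\<int> :: 'k set)" "of_rat (N x) / of_rat q \<in> (\<int> :: 'k set)" "of_rat (N y) / of_rat q \<in> (\<int> :: 'k set)"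
      using that by (auto intro!: qG simp: G_def)
    moreover from this(2,3) have "(of_rat (N x) / of_rat q) * (of_rat (N y) / of_rat q) \<in> (\<int> :: 'k set)"
      by (rule Ints_mult)
    moreover have "cnj (x * cnj y / of_rat q) = y * cnj x / of_rat q"
      by (simp add: conj_divide_rat conj_mult mult.commute)
    ultimately show ?thesis
      unfolding integers_of_iff by (simp add: N T add_divide_distrib mult_ac)
  qed
  \<comment> \<open>Integrality extends from the generators to all of \<open>I\<close> in the first
    factor; the second factor follows through \<open>conj_scaled_ospan\<close>.\<close>
  have IX: "x * cnj y / of_rat q \<in> oo" if "x \<in> I" "y \<in> X" for x y
  proof -
    have "K.submod {x. cnj y / of_rat q * x \<in> oo}"
      by (rule K.submod_smul_preimage[OF submod_oo])
    then have "I \<subseteq> {x. cnj y / of_rat q * x \<in> oo}"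
      unfolding X(2) using XX that(2) by (intro K.ospan_minimal) (auto simp: mult.commute)
    with that show ?thesis by (auto simp: mult.commute)
  qed
  have "K.prd I ?J \<subseteq> oo"
  proof (rule K.prd_least[OF submod_oo])
    fix x y assume x: "x \<in> I" and y: "y \<in> ?J"
    have "K.ospan (conj_scaled q X) \<subseteq> {y. x * y \<in> oo}"
      using IX[OF x]
      by (intro K.ospan_minimal K.submod_smul_preimage[OF submod_oo]) (auto simp: conj_scaled_def)
    then show "x * y \<in> oo"
      using y q unfolding X(2) by (auto simp: conj_scaled_ospan)
  qed
  moreover have "1 \<in> K.prd I ?J"
  proof -
    \<comment> \<open>An additive group closed under integer multiples. It contains
      \<open>G\<close>, hence \<open>q0\<close>.\<close>
    define M where "M = {r. of_rat r / of_rat q \<in> K.prd I ?J}"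
    have "K.submod (K.prd I ?J)" by (rule K.submod_prd)
    have IJ: "x * (cnj y / of_rat q) \<in> K.prd I ?J" if "x \<in> I" "y \<in> I" for x y
      using that by (intro K.prdI) (auto simp: conj_scaled_def)
    have "q0 \<in> M"
    proof (rule q0(2))
      show "0 \<in> M" by (simp add: M_def K.submod_zero K.submod_prd)
      show "\<forall>x\<in>M. \<forall>y\<in>M. x + y \<in> M"
        by (auto simp: M_def of_rat_add add_divide_distrib intro!: K.submod_add[OF K.submod_prd])
      show "\<forall>n. \<forall>x\<in>M. of_int n * x \<in> M"
      proof (intro allI ballI)
        fix n x assume "x \<in> M"
        then have "of_int n * (of_rat x / of_rat q) \<in> K.prd I ?J"
          unfolding M_def by (intro K.submod_smul[OF K.submod_prd] Ints_int) auto
        then show "of_int n * x \<in> M" by (simp add: M_def of_rat_mult)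
      qed
      show "G \<subseteq> M"
      proof
        fix g assume "g \<in> G"
        then consider x where "x \<in> X" "g = N x" | x y where "x \<in> X" "y \<in> X" "g = T x y"
          by (auto simp: G_def)
        then show "g \<in> M"
        proof cases
          case 1
          then show ?thesis using IJ[of x x] XI by (auto simp: M_def N)
        next
          case 2
          then have "x * (cnj y / of_rat q) + y * (cnj x / of_rat q) \<in> K.prd I ?J"
            using XI by (intro K.submod_add[OF K.submod_prd] IJ) auto
          then show ?thesis using 2 by (simp add: M_def T add_divide_distrib)
        qed
      qed
    qed
    then have *: "of_rat q0 / of_rat q \<in> K.prd I ?J" by (simp add: M_def)
    show ?thesis
    proof (cases "q0 > 0")
      case True
      with * show ?thesis by (simp add: q_def)
    next
      case False
      then have "of_rat q0 / of_rat q = (- 1 :: 'k)"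
        using \<open>q0 \<noteq> 0\<close> by (simp add: q_def abs_if of_rat_minus)
      with * have "- 1 * - 1 \<in> K.prd I ?J"
        by (intro K.submod_smul[OF K.submod_prd] Ints_int) auto
      then show ?thesis by simp
    qed
  qed
  then have "oo \<subseteq> K.prd I ?J"
    unfolding oo_eq_ospan by (intro K.ospan_minimal K.submod_prd) auto
  ultimately show ?thesis using q by blast
qed

lemma comm_group_ideal_group: "comm_group (ideal_group :: 'k set monoid)"
proof (rule comm_groupI)
  fix I J L :: "'k set"
  assume I: "I \<in> carrier ideal_group"
  then show "\<one>\<^bsub>ideal_group\<^esub> \<otimes>\<^bsub>ideal_group\<^esub> I = I"
    by (simp add: ideal_group_def ideal_product_eq K.prd_one fractional_ideal_submod)
  obtain q where "q > 0" "K.prd I (conj_scaled q I) = oo"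
    using I ideal_inverse by (auto simp: ideal_group_def)
  then show "\<exists>J\<in>carrier ideal_group. J \<otimes>\<^bsub>ideal_group\<^esub> I = \<one>\<^bsub>ideal_group\<^esub>"
    using I fractional_ideal_conj_scaled[of I q]
    by (intro bexI[of _ "conj_scaled q I"]) (auto simp: ideal_group_def ideal_product_eq prd_comm)
  show "I \<otimes>\<^bsub>ideal_group\<^esub> J = J \<otimes>\<^bsub>ideal_group\<^esub> I"
    by (simp add: ideal_group_def ideal_product_eq prd_comm[of I J])
qed (simp_all add: ideal_group_def ideal_product_eq K.prd_assoc fractional_ideal_oo fractional_ideal_prd)

lemma prd_principal: "K.prd (K.ospan {x}) (K.ospan {y}) = K.ospan {x * y}"
  by (simp add: K.prd_ospan)

lemma subgroup_principal_ideals: "subgroup principal_ideals (ideal_group :: 'k set monoid)"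
proof -
  interpret comm_group "ideal_group :: 'k set monoid" by (rule comm_group_ideal_group)
  have inv: "inv\<^bsub>ideal_group\<^esub> (K.ospan {x}) = K.ospan {inverse x}" if "x \<noteq> 0" for x
    using that by (intro inv_equality)
      (auto simp: ideal_group_def ideal_product_eq prd_principal oo_eq_ospan fractional_ideal_principal)
  show ?thesis
  proof (rule subgroupI)
    show "principal_ideals \<subseteq> carrier (ideal_group :: 'k set monoid)"
      by (auto simp: principal_ideals_def ideal_group_def fractional_ideal_principal)
    show "principal_ideals \<noteq> ({} :: 'k set set)"
      by (auto simp: principal_ideals_def intro!: exI[of _ 1])
  next
    fix I :: "'k set" assume "I \<in> principal_ideals"
    then show "inv\<^bsub>ideal_group\<^esub> I \<in> principal_ideals"
      unfolding principal_ideals_def using inv by (smt (verit) mem_Collect_eq nonzero_imp_inverse_nonzero)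
  next
    fix I J :: "'k set" assume "I \<in> principal_ideals" "J \<in> principal_ideals"
    then show "I \<otimes>\<^bsub>ideal_group\<^esub> J \<in> principal_ideals"
      unfolding principal_ideals_def
      by (auto simp: ideal_group_def ideal_product_eq prd_principal)
  qed
qed

sublocale IG: comm_group "ideal_group :: 'k set monoid"
  by (rule comm_group_ideal_group)

lemma normal_principal_ideals: "principal_ideals \<lhd> (ideal_group :: 'k set monoid)"
  using IG.subgroup_imp_normal[OF subgroup_principal_ideals] .

lemma comm_group_class_group: "comm_group (class_group :: 'k set set monoid)"
  unfolding class_group_def by (rule IG.abelian_FactGroup[OF subgroup_principal_ideals])

sublocale CG: comm_group "class_group :: 'k set set monoid"
  by (rule comm_group_class_group)

lemma carrier_class_group: "carrier class_group = ideal_class ` {I :: 'k set. fractional_ideal I}"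
  by (simp add: class_group_def carrier_FactGroup ideal_class_def[abs_def] ideal_group_def)

lemma ideal_class_mult:
  fixes I J :: "'k set"
  assumes "fractional_ideal I" "fractional_ideal J"
  shows "ideal_class (K.prd I J) = ideal_class I \<otimes>\<^bsub>class_group\<^esub> ideal_class J"
  using normal.rcos_sum[OF normal_principal_ideals, of I J] assms
  by (simp add: class_group_def ideal_class_def ideal_group_def ideal_product_eq)

lemma ideal_class_pow:
  fixes I :: "'k set"
  assumes "fractional_ideal I"
  shows "ideal_class (I [^]\<^bsub>ideal_group\<^esub> (n :: nat)) = ideal_class I [^]\<^bsub>class_group\<^esub> n"
  using normal.FactGroup_pow[OF normal_principal_ideals, of I n] assms
  by (simp add: class_group_def ideal_class_def ideal_group_def)

end


section \<open>Rescaling hermitian lattices\<close>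

lemma hermitian_form_iff:
  fixes h :: "('k::field, 'n::finite) form"
  shows "hermitian_form h \<longleftrightarrow> (\<forall>x x' y. h (x + x') y = h x y + h x' y) \<and>
    (\<forall>a x y. h (a *s x) y = a * h x y) \<and> (\<forall>x y. h y x = conjugation (h x y))"
  unfolding hermitian_form_def
  by (simp add: Vector_Spaces.linear_iff_module_hom module_hom_iff vec.module_axioms
      vector_space_over_itself.module_axioms) blast

lemma linear_vec_iff:
  fixes f :: "'k::field^'n::finite \<Rightarrow> 'k^'m::finite"
  shows "Vector_Spaces.linear (*s) (*s) f \<longleftrightarrow>
    (\<forall>x y. f (x + y) = f x + f y) \<and> (\<forall>a x. f (a *s x) = a *s f x)"
  by (auto simp: Vector_Spaces.linear_iff_module_hom module_hom_iff vec.module_axioms)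

section \<open>Isometry classes and their number\<close>

lemma equiv_lattice_isometry:
  "equiv UNIV (lattice_isometry :: ((('k::field, 'n::finite) form \<times> ('k^'n) set) \<times> _) set)"
proof (rule equivI)
  show "refl (lattice_isometry :: ((('k, 'n) form \<times> ('k^'n) set) \<times> _) set)"
    unfolding lattice_isometry_def refl_on_def
    by (auto intro!: exI[of _ id] simp: linear_vec_iff)
  show "sym (lattice_isometry :: ((('k, 'n) form \<times> ('k^'n) set) \<times> _) set)"
  proof (rule symI)
    fix P P' :: "('k, 'n) form \<times> ('k^'n) set"
    assume "(P, P') \<in> lattice_isometry"
    then obtain h L h' L' s where P: "P = (h, L)" "P' = (h', L')"
      and s: "Vector_Spaces.linear (*s) (*s) s" "bij s" "\<And>x y. h' (s x) (s y) = h x y" "s ` L = L'"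
      unfolding lattice_isometry_def by blast
    have inv: "s (inv_into UNIV s x) = x" "inv_into UNIV s (s x) = x" for x
      using s(2) by (auto simp: bij_is_surj surj_f_inv_f bij_is_inj)
    have "h (inv_into UNIV s x) (inv_into UNIV s y) = h' x y" for x y
      by (metis s(3) inv(1))
    moreover have "Vector_Spaces.linear (*s) (*s) (inv_into UNIV s)"
      using s(1) unfolding linear_vec_iff by (metis inv)
    moreover have "inv_into UNIV s ` L' = L"
      using inv(2) by (auto simp: s(4)[symmetric] image_image)
    ultimately show "(P', P) \<in> lattice_isometry"
      unfolding lattice_isometry_def P using bij_imp_bij_inv[OF s(2)] by blast
  qed
  show "trans (lattice_isometry :: ((('k, 'n) form \<times> ('k^'n) set) \<times> _) set)"
  proof (rule transI)
    fix P P' P'' :: "('k, 'n) form \<times> ('k^'n) set"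
    assume "(P, P') \<in> lattice_isometry" "(P', P'') \<in> lattice_isometry"
    then obtain h L h' L' h'' L'' s t where P: "P = (h, L)" "P' = (h', L')" "P'' = (h'', L'')"
      and s: "Vector_Spaces.linear (*s) (*s) s" "bij s" "\<And>x y. h' (s x) (s y) = h x y" "s ` L = L'"
      and t: "Vector_Spaces.linear (*s) (*s) t" "bij t" "\<And>x y. h'' (t x) (t y) = h' x y" "t ` L' = L''"
      unfolding lattice_isometry_def by blast
    show "(P, P'') \<in> lattice_isometry"
      unfolding lattice_isometry_def P using s t
      by (auto intro!: exI[of _ "t \<circ> s"] bij_comp simp: linear_vec_iff image_comp[symmetric])
  qed
qed simp

text \<open>The members of \<open>X // r\<close> are the classes of the whole type that meet
  \<open>X\<close>. Sending a class to the saturation of its image under \<open>f\<close> is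
  inverted by the same construction with \<open>g\<close>.\<close>

lemma card_quotient_eqI:
  assumes r: "equiv UNIV r"
    and f: "\<And>x y. (x, y) \<in> r \<Longrightarrow> (f x, f y) \<in> r" "\<And>x. x \<in> X \<Longrightarrow> f x \<in> Y"
    and g: "\<And>x y. (x, y) \<in> r \<Longrightarrow> (g x, g y) \<in> r" "\<And>y. y \<in> Y \<Longrightarrow> g y \<in> X"
    and gf: "\<And>x. x \<in> X \<Longrightarrow> g (f x) = x" and fg: "\<And>y. y \<in> Y \<Longrightarrow> f (g y) = y"
  shows "card (X // r) = card (Y // r)"
proof -
  have cls: "r `` (u ` (r `` {x})) = r `` {u x}" if u: "\<And>x y. (x, y) \<in> r \<Longrightarrow> (u x, u y) \<in> r" for u x
  proof -
    have "x \<in> r `` {x}"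
      using r by (rule equiv_class_self) simp
    moreover have "r `` {u z} = r `` {u x}" if "z \<in> r `` {x}" for z
      using that u[of x z] r by (auto dest: equiv_class_eq)
    ultimately show ?thesis by blast
  qed
  have "bij_betw (\<lambda>Q. r `` (f ` Q)) (X // r) (Y // r)"
  proof (rule bij_betw_byWitness[of _ "\<lambda>Q. r `` (g ` Q)"])
    show "\<forall>Q\<in>X // r. r `` (g ` (r `` (f ` Q))) = Q"
    proof
      fix Q assume "Q \<in> X // r"
      then obtain x where "x \<in> X" "Q = r `` {x}" by (rule quotientE)
      then show "r `` (g ` (r `` (f ` Q))) = Q"
        by (simp add: cls[of f, OF f(1)] cls[of g, OF g(1)] gf)
    qed
    show "\<forall>Q\<in>Y // r. r `` (f ` (r `` (g ` Q))) = Q"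
    proof
      fix Q assume "Q \<in> Y // r"
      then obtain x where "x \<in> Y" "Q = r `` {x}" by (rule quotientE)
      then show "r `` (f ` (r `` (g ` Q))) = Q"
        by (simp add: cls[of f, OF f(1)] cls[of g, OF g(1)] fg)
    qed
    show "(\<lambda>Q. r `` (f ` Q)) ` (X // r) \<subseteq> Y // r"
      by (auto elim!: quotientE simp: cls[of f, OF f(1)] intro!: quotientI f(2))
    show "(\<lambda>Q. r `` (g ` Q)) ` (Y // r) \<subseteq> X // r"
      by (auto elim!: quotientE simp: cls[of g, OF g(1)] intro!: quotientI g(2))
  qed
  then show ?thesis by (rule bij_betw_same_card)
qed

text \<open>The case \<open>e = 0\<close> is included: there \<open>k\<close> is a multiple of \<open>n\<close>.\<close>

lemma (in comm_group) nth_power_of_gcd_dvd: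
  fixes n e k :: nat
  assumes e: "\<And>x. x \<in> carrier G \<Longrightarrow> x [^] e = \<one>" and n: "n > 0" and k: "gcd n e dvd k"
    and C: "C \<in> carrier G"
  shows "\<exists>D\<in>carrier G. D [^] n = C [^] k"
proof -
  \<comment> \<open>Bezout without subtraction, so that all exponents stay natural numbers.\<close>
  obtain x y where xy: "n * x = e * y + gcd n e"
    using bezout_nat[of n e] n by auto
  obtain m where m: "k = gcd n e * m"
    using k by auto
  have "x * m * n = e * (y * m) + k"
    unfolding m using xy by (metis add_mult_distrib mult.assoc mult.commute)
  \<comment> \<open>The first factor on the right is trivial by \<open>e\<close>, so
    \<open>C [^] (x * m)\<close> is the required root.\<close>
  then have "(C [^] (x * m)) [^] n = (C [^] e) [^] (y * m) \<otimes> C [^] k"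
    using C by (simp add: nat_pow_pow nat_pow_mult)
  then show ?thesis
    using C e by (intro bexI[of _ "C [^] (x * m)"]) auto
qed

text \<open>Both branches of the definition satisfy this: the least exponent by choice, and the
  default 0 since it gives the empty power.\<close>

lemma (in group) pow_group_exponent:
  assumes "x \<in> carrier G"
  shows "x [^] group_exponent G = \<one>"
proof (cases "\<exists>e::nat>0. \<forall>x\<in>carrier G. x [^] e = \<one>")
  case True
  then have "\<exists>e::nat. 0 < e \<and> (\<forall>x\<in>carrier G. x [^] e = \<one>)"
    by blast
  from LeastI_ex[OF this] True assms show ?thesis
    by (simp add: group_exponent_def)
next
  case False
  then have "group_exponent G = 0"
    unfolding group_exponent_def Let_def by (rule if_not_P)
  then show ?thesis by simp
qed

text \<open>As \<open>I\<close> absorbs integral scalars, products alone generate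
  \<open>prd I M\<close> as an additive group. This serves conditions on vectors that are additive
  but not visibly stable under \<open>oo\<close>.\<close>

lemma (in integral_module) prd_least_additive:
  assumes "K.submod I" "0 \<in> A" "\<And>x y. x \<in> A \<Longrightarrow> y \<in> A \<Longrightarrow> x + y \<in> A"
    "\<And>x y. x \<in> I \<Longrightarrow> y \<in> M \<Longrightarrow> smul x y \<in> A"
  shows "prd I M \<subseteq> A"
proof -
  \<comment> \<open>The vectors whose integral multiples all stay in \<open>A\<close> form a
    submodule.\<close>
  have "prd I M \<subseteq> {x. \<forall>s\<in>oo. smul s x \<in> A}"
  proof (rule prd_least)
    show "submod {x. \<forall>s\<in>oo. smul s x \<in> A}"
      using assms(2,3) by (auto simp: submod_def scale_right_distrib intro: int_mult)
    show "smul x y \<in> {x. \<forall>s\<in>oo. smul s x \<in> A}" if "x \<in> I" "y \<in> M" for x y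
      using that assms(4) K.submod_smul[OF assms(1)] by simp
  qed
  then show ?thesis
    using one_int by fastforce
qed

section \<open>Products of ideals with lattices\<close>

locale hermitian_lattices = imaginary_quadratic ty
  for ty :: "'k::field_char_0 itself" +
  fixes tyn :: "'n::finite itself"

sublocale hermitian_lattices \<subseteq> V: integral_module ty "(*s) :: 'k \<Rightarrow> 'k^'n \<Rightarrow> 'k^'n"
  by unfold_locales

context hermitian_lattices
begin

lemma image_prd:
  assumes s: "Vector_Spaces.linear (*s) (*s) s"
  shows "s ` V.prd I L = V.prd I (s ` L)"
proof
  have add: "s (x + y) = s x + s y" and scale: "s (a *s x) = a *s s x" for x y a
    using s by (auto simp: linear_vec_iff)
  have zero: "s 0 = 0"
    using scale[of 0 0] by simp
  have "V.prd I L \<subseteq> {x. s x \<in> V.prd I (s ` L)}"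
    by (intro V.prd_least V.submod_preimage V.submod_prd)
      (auto simp: add scale zero intro: V.prdI)
  then show "s ` V.prd I L \<subseteq> V.prd I (s ` L)" by blast
  show "V.prd I (s ` L) \<subseteq> s ` V.prd I L"
  proof (rule V.prd_least)
    have sub: "V.submod (V.prd I L)" by (rule V.submod_prd)
    show "V.submod (s ` V.prd I L)"
      unfolding V.submod_def
    proof (intro conjI ballI)
      show "0 \<in> s ` V.prd I L"
        using V.submod_zero[OF sub] zero by (metis imageI)
    next
      fix x y assume "x \<in> s ` V.prd I L" "y \<in> s ` V.prd I L"
      then show "x + y \<in> s ` V.prd I L"
        using V.submod_add[OF sub] by (auto simp flip: add)
    next
      fix a x assume "a \<in> oo" "x \<in> s ` V.prd I L"
      then show "a *s x \<in> s ` V.prd I L"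
        using V.submod_smul[OF sub] by (auto simp flip: scale)
    qed
    fix x y assume "x \<in> I" "y \<in> s ` L"
    then show "x *s y \<in> s ` V.prd I L"
      by (auto simp flip: scale intro: V.prdI)
  qed
qed

text \<open>Dividing the form by \<open>q\<close> compensates the factor that \<open>I\<close> and
  its conjugate contribute when \<open>L\<close> is multiplied by \<open>I\<close>.\<close>

definition rescale :: "'k set \<Rightarrow> rat \<Rightarrow> ('k, 'n) form \<times> ('k^'n) set \<Rightarrow> ('k, 'n) form \<times> ('k^'n) set" where
  "rescale I q P = (\<lambda>x y. fst P x y / of_rat q, V.prd I (snd P))"

lemma rescale_isometry:
  assumes "(P, P') \<in> lattice_isometry"
  shows "(rescale I q P, rescale I q P') \<in> lattice_isometry"
proof -
  obtain h L h' L' s where "P = (h, L)" "P' = (h', L')"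
    "Vector_Spaces.linear (*s) (*s) s" "bij s" "\<And>x y. h' (s x) (s y) = h x y" "s ` L = L'"
    using assms unfolding lattice_isometry_def by blast
  then show ?thesis
    unfolding lattice_isometry_def rescale_def using image_prd[of s I L] by auto
qed

text \<open>Multiplication by \<open>I\<close> keeps the basis \<open>x\<close> and replaces each
  coefficient ideal \<open>a i\<close> by its product with \<open>I\<close>, so the product of all
  of them gains the factor \<open>I\<close> once per index.\<close>

lemma steinitz_prd:
  assumes I: "fractional_ideal (I :: 'k set)" and L: "has_steinitz_class (L :: ('k^'n) set) C"
  shows "has_steinitz_class (V.prd I L) (ideal_class I [^]\<^bsub>class_group\<^esub> CARD('n) \<otimes>\<^bsub>class_group\<^esub> C)"
proof -
  obtain a :: "'n \<Rightarrow> 'k set" and x :: "'n \<Rightarrow> 'k^'n"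
    where a: "\<And>i. fractional_ideal (a i)"
      and x: "inj x" "vec.independent (range x)" "vec.span (range x) = UNIV"
      and L: "L = {\<Sum>i\<in>UNIV. c i *s x i | c. \<forall>i. c i \<in> a i}"
      and C: "C = ideal_class (finprod ideal_group a UNIV)"
    using L unfolding has_steinitz_class_def by blast
  let ?b = "\<lambda>i. K.prd I (a i)"
  let ?R = "{\<Sum>i\<in>UNIV. c i *s x i | c. \<forall>i. c i \<in> ?b i}"
  have "V.prd I L = ?R"
  proof
    have sub: "K.submod (?b i)" for i by (rule K.submod_prd)
    show "V.prd I L \<subseteq> ?R"
    proof (rule V.prd_least)
      show "V.submod ?R" unfolding V.submod_def
      proof (intro conjI ballI)
        show "0 \<in> ?R"
          by (rule CollectI, rule exI[of _ "\<lambda>_. 0"]) (simp add: K.submod_zero[OF sub])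
      next
        fix y z assume "y \<in> ?R" "z \<in> ?R"
        then obtain c d where "y = (\<Sum>i\<in>UNIV. c i *s x i)" "\<forall>i. c i \<in> ?b i"
          "z = (\<Sum>i\<in>UNIV. d i *s x i)" "\<forall>i. d i \<in> ?b i" by blast
        then show "y + z \<in> ?R"
          by (intro CollectI exI[of _ "\<lambda>i. c i + d i"])
            (simp add: K.submod_add[OF sub] sum.distrib vec.scale_left_distrib)
      next
        fix r y assume "r \<in> oo" "y \<in> ?R"
        then obtain c where "r \<in> oo" "y = (\<Sum>i\<in>UNIV. c i *s x i)" "\<forall>i. c i \<in> ?b i" by blast
        then show "r *s y \<in> ?R"
          by (intro CollectI exI[of _ "\<lambda>i. r * c i"])
            (simp add: K.submod_smul[OF sub] vec.scale_sum_right)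
      qed
      fix r y assume "r \<in> I" "y \<in> L"
      then obtain c where "r \<in> I" "y = (\<Sum>i\<in>UNIV. c i *s x i)" "\<forall>i. c i \<in> a i"
        unfolding L by blast
      then show "r *s y \<in> ?R"
        by (intro CollectI exI[of _ "\<lambda>i. r * c i"]) (simp add: K.prdI vec.scale_sum_right)
    qed
    show "?R \<subseteq> V.prd I L"
    proof
      fix y assume "y \<in> ?R"
      then obtain c where y: "y = (\<Sum>i\<in>UNIV. c i *s x i)" and c: "\<And>i. c i \<in> ?b i" by blast
      have ax: "s *s x i \<in> L" if "s \<in> a i" for s i
      proof -
        \<comment> \<open>A single summand is an element of \<open>L\<close> with all other
          coefficients 0.\<close>
        have "s *s x i = (\<Sum>j\<in>UNIV. (if j = i then s else 0) *s x j)"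
          by (simp add: if_distrib[of "\<lambda>r. r *s _"] sum.delta cong: if_cong)
        moreover have "(if j = i then s else 0) \<in> a j" for j
          using that K.submod_zero[OF fractional_ideal_submod[OF a]] by auto
        ultimately show ?thesis
          unfolding L by (intro CollectI exI[of _ "\<lambda>j. if j = i then s else 0"]) simp
      qed
      have "K.prd I (a i) \<subseteq> {r. r *s x i \<in> V.prd I L}" for i
      proof (rule K.prd_least[OF V.submod_coeff_preimage[OF V.submod_prd]])
        fix r s assume "r \<in> I" "s \<in> a i"
        then have "r *s (s *s x i) \<in> V.prd I L"
          by (intro V.prdI ax)
        then show "r * s \<in> {r. r *s x i \<in> V.prd I L}"
          by (simp add: vec.scale_scale)
      qed
      with c show "y \<in> V.prd I L"
        unfolding y by (intro V.submod_sum V.submod_prd) blast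
    qed
  qed
  moreover have "ideal_class (finprod ideal_group ?b UNIV) =
    ideal_class I [^]\<^bsub>class_group\<^esub> CARD('n) \<otimes>\<^bsub>class_group\<^esub> C"
  proof -
    have car: "carrier ideal_group = {I :: 'k set. fractional_ideal I}"
      by (simp add: ideal_group_def)
    have "finprod ideal_group ?b UNIV = finprod ideal_group (\<lambda>i. I \<otimes>\<^bsub>ideal_group\<^esub> a i) UNIV"
      by (simp add: ideal_group_def ideal_product_eq)
    also have "\<dots> = I [^]\<^bsub>ideal_group\<^esub> CARD('n) \<otimes>\<^bsub>ideal_group\<^esub> finprod ideal_group a UNIV"
      using I a by (simp add: car IG.finprod_const)
    also have "\<dots> = K.prd (I [^]\<^bsub>ideal_group\<^esub> CARD('n)) (finprod ideal_group a UNIV)"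
      by (simp add: ideal_group_def ideal_product_eq)
    finally show ?thesis
      using IG.nat_pow_closed[of I "CARD('n)"] IG.finprod_closed[of a UNIV] I a
      by (simp add: car ideal_class_mult ideal_class_pow C)
  qed
  ultimately show ?thesis
    unfolding has_steinitz_class_def using a x I fractional_ideal_prd
    by (intro exI[of _ ?b] exI[of _ x]) auto
qed

text \<open>A nonzero \<open>r\<close> in \<open>I\<close> puts a nonzero multiple of every vector
  of \<open>L\<close> into the product, so the span remains everything.\<close>

lemma lattice_in_space_prd:
  assumes I: "fractional_ideal (I :: 'k set)" and L: "lattice_in_space (L :: ('k^'n) set)"
  shows "lattice_in_space (V.prd I L)"
proof -
  obtain r where r: "r \<in> I" "r \<noteq> 0"
    using fractional_ideal_nonzero[OF I] .
  have "L \<subseteq> vec.span (V.prd I L)"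
  proof
    fix x assume "x \<in> L"
    then have "r *s x \<in> vec.span (V.prd I L)"
      using r by (intro vec.span_base V.prdI)
    then have "inverse r *s (r *s x) \<in> vec.span (V.prd I L)"
      by (rule vec.span_scale)
    with r show "x \<in> vec.span (V.prd I L)" by simp
  qed
  then have "vec.span L \<subseteq> vec.span (V.prd I L)"
    by (rule vec.span_minimal[OF _ vec.subspace_span])
  then show ?thesis
    using L I V.prd_finitely_generated unfolding lattice_in_space_def fractional_ideal_def by (metis top.extremum_uniqueI)
qed

lemma lattice_in_space_submod: "lattice_in_space (L :: ('k^'n) set) \<Longrightarrow> V.submod L"
  unfolding lattice_in_space_def using V.submod_ospan by blast

section \<open>Forms and unimodularity under rescaling\<close>

context
  fixes h :: "('k, 'n) form"
  assumes h: "hermitian_form h"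
begin

lemma form_add: "h (x + x') y = h x y + h x' y" "h x (y + y') = h x y + h x y'"
  and form_scale: "h (a *s x) y = a * h x y" "h x (a *s y) = cnj a * h x y"
  and form_conj: "h y x = cnj (h x y)"
  using h unfolding hermitian_form_iff by (metis conj_add conj_mult)+

lemma form_zero: "h 0 y = 0" "h x 0 = 0"
  using form_scale(1)[of 0 0 y] form_scale(2)[of x 0 0] by (simp_all add: conj.zero)

end

lemma hermitian_form_divide:
  assumes "hermitian_form (h :: ('k, 'n) form)"
  shows "hermitian_form (\<lambda>x y. h x y / of_rat q)"
  unfolding hermitian_form_iff
proof (intro conjI allI)
  show "h y x / of_rat q = cnj (h x y / of_rat q)" for x y
    unfolding conj_divide_rat by (metis form_conj[OF assms])
qed (simp_all add: form_add[OF assms] form_scale[OF assms] add_divide_distrib)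

lemma positive_definite_divide:
  assumes "positive_definite (h :: ('k, 'n) form)" "q > 0"
  shows "positive_definite (\<lambda>x y. h x y / of_rat q)"
  unfolding positive_definite_def
proof (intro allI impI)
  fix x :: "'k^'n" assume "x \<noteq> 0"
  then obtain r where "r > 0" "h x x = of_rat r"
    using assms(1) unfolding positive_definite_def by blast
  with assms(2) show "\<exists>r>0. h x x / of_rat q = of_rat r"
    by (intro exI[of _ "r / q"]) (simp add: of_rat_divide)
qed

lemma mem_unimodular: "unimodular h L \<Longrightarrow> x \<in> L \<Longrightarrow> y \<in> L \<Longrightarrow> h x y \<in> oo"
  unfolding unimodular_def by blast

lemma conj_scaled_mem:
  assumes "K.prd I (conj_scaled q I) = oo" "a \<in> I" "b \<in> I"
  shows "a * cnj b / of_rat q \<in> oo"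
  using K.prdI[of a I "cnj b / of_rat q" "conj_scaled q I"] assms by (auto simp: conj_scaled_def)

text \<open>Integrality on the product holds because \<open>a * cnj b / q\<close> is integral for
  \<open>a\<close>, \<open>b\<close> in \<open>I\<close>. Conversely, if \<open>x\<close> is in the
  dual, then the inverse ideal \<open>J\<close> carries \<open>x\<close> into the dual of
  \<open>L\<close>, which is \<open>L\<close>; hence \<open>x\<close>, lying in
  \<open>I J x\<close>, lies in \<open>I L\<close>.\<close>

lemma unimodular_rescale:
  assumes h: "hermitian_form (h :: ('k, 'n) form)" and q: "q > 0"
    and I: "K.prd I (conj_scaled q I) = oo" and L: "unimodular h L"
  shows "unimodular (\<lambda>x y. h x y / of_rat q) (V.prd I L)"
  unfolding unimodular_def
proof (intro equalityI subsetI CollectI ballI)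
  fix x y assume x: "x \<in> V.prd I L" and y: "y \<in> V.prd I L"
  have "h (a *s u) (b *s v) / of_rat q \<in> oo" if "a \<in> I" "b \<in> I" "u \<in> L" "v \<in> L" for a b u v
    using int_mult[OF conj_scaled_mem[OF I that(1,2)] mem_unimodular[OF L that(3,4)]]
    by (simp add: form_scale[OF h] mult_ac)
  \<comment> \<open>The form is linear only in its first argument, so the second vector is treated
    there and moved back by conjugation.\<close>
  then have "V.prd I L \<subseteq> {y. h y (a *s u) / of_rat q \<in> oo}" if "a \<in> I" "u \<in> L" for a u
    using that
    by (intro V.prd_least)
      (auto simp: V.submod_def form_add[OF h] form_scale(1)[OF h] form_zero[OF h]
        add_divide_distrib simp flip: times_divide_eq_right intro: int_add int_mult)
  then have "cnj (h y (a *s u) / of_rat q) \<in> oo" if "a \<in> I" "u \<in> L" for a u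
    using that y by (blast intro: conj_int)
  then have "h (a *s u) y / of_rat q \<in> oo" if "a \<in> I" "u \<in> L" for a u
    using that by (metis conj_divide_rat form_conj[OF h])
  then have "V.prd I L \<subseteq> {x. h x y / of_rat q \<in> oo}"
    by (intro V.prd_least)
      (auto simp: V.submod_def form_add[OF h] form_scale[OF h] form_zero[OF h]
        add_divide_distrib simp flip: times_divide_eq_right intro: int_add int_mult)
  with x show "h x y / of_rat q \<in> oo" by blast
next
  fix x assume "x \<in> {x. \<forall>y\<in>V.prd I L. h x y / of_rat q \<in> oo}"
  then have x: "h x y / of_rat q \<in> oo" if "y \<in> V.prd I L" for y
    using that by blast
  have jx: "j *s x \<in> L" if j: "j \<in> conj_scaled q I" for j
  proof -
    obtain b where b: "b \<in> I" "j = cnj b / of_rat q"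
      using j by (auto simp: conj_scaled_def)
    \<comment> \<open>The scalar moves across the form:
      \<open>h (j *s x) v = h x (b *s v) / q\<close>.\<close>
    have "h (j *s x) v \<in> oo" if "v \<in> L" for v
      using x[OF V.prdI[OF b(1) that]] by (simp add: form_scale[OF h] b(2))
    then show ?thesis
      using L unfolding unimodular_def by blast
  qed
  have "K.prd I (conj_scaled q I) \<subseteq> {r. r *s x \<in> V.prd I L}"
  proof (intro K.prd_least[OF V.submod_coeff_preimage[OF V.submod_prd]])
    fix r j assume "r \<in> I" "j \<in> conj_scaled q I"
    then have "r *s (j *s x) \<in> V.prd I L"
      by (intro V.prdI jx)
    then show "r * j \<in> {r. r *s x \<in> V.prd I L}"
      by (simp add: vec.scale_scale)
  qed
  then have "1 *s x \<in> V.prd I L"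
    unfolding I using one_int by blast
  then show "x \<in> V.prd I L" by simp
qed

section \<open>Parity under rescaling\<close>

definition even_integers :: "'k set" where
  "even_integers = {2 * a | a. a \<in> oo}"

lemma submod_even_integers: "K.submod even_integers"
  unfolding K.submod_def even_integers_def
proof (intro conjI ballI)
  show "0 \<in> {2 * a | a. a \<in> oo}"
    by (auto intro!: exI[of _ 0])
next
  fix x y assume "x \<in> {2 * a | a. a \<in> oo}" "y \<in> {2 * a | a. a \<in> oo}"
  then obtain a b where "x = 2 * a" "y = 2 * b" "a \<in> oo" "b \<in> oo" by blast
  then show "x + y \<in> {2 * a | a. a \<in> oo}"
    by (intro CollectI exI[of _ "a + b"]) (simp add: int_add)
next
  fix r x assume "r \<in> oo" "x \<in> {2 * a | a. a \<in> oo}"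
  then obtain a where "r \<in> oo" "x = 2 * a" "a \<in> oo" by blast
  then show "r * x \<in> {2 * a | a. a \<in> oo}"
    by (intro CollectI exI[of _ "r * a"]) (simp add: int_mult)
qed

lemma even_lattice_iff:
  fixes L :: "('k^'n) set"
  shows "even_lattice h L \<longleftrightarrow> (\<forall>x\<in>L. h x x \<in> even_integers)"
  unfolding even_lattice_def norm_ideal_def even_integers_def[symmetric]
  using K.ospan_minimal[OF submod_even_integers, of "{h x x | x. x \<in> L}"]
    K.ospan_superset[of _ "{h x x | x. x \<in> L}"] by blast

text \<open>Polarization: this is \<open>h (x + y) (x + y)\<close> minus \<open>h x x\<close> and
  \<open>h y y\<close>.\<close>

lemma even_lattice_trace:
  assumes h: "hermitian_form (h :: ('k, 'n) form)" and L: "even_lattice h L" "V.submod L"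
    and xy: "x \<in> L" "y \<in> L"
  shows "h x y + h y x \<in> even_integers"
proof -
  have ev: "h z z \<in> even_integers" if "z \<in> L" for z
    using L(1) that by (simp add: even_lattice_iff)
  have "h (x + y) (x + y) + (- 1) * (h x x + h y y) \<in> even_integers"
    using xy by (intro K.submod_add[OF submod_even_integers] K.submod_smul[OF submod_even_integers]
        ev V.submod_add[OF L(2)]) (auto intro: Ints_int)
  then show ?thesis
    by (simp add: form_add[OF h] algebra_simps)
qed

lemma even_lattice_rescale:
  assumes h: "hermitian_form (h :: ('k, 'n) form)" and I: "fractional_ideal I" "K.prd I (conj_scaled q I) = oo"
    and L: "V.submod L" "even_lattice h L"
  shows "even_lattice (\<lambda>x y. h x y / of_rat q) (V.prd I L)"
proof -
  have smI: "K.submod I" by (rule fractional_ideal_submod[OF I(1)])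
  \<comment> \<open>On \<open>I L\<close> the traces of \<open>h/q\<close> are even, because a coefficient \<open>a b\<^sup>*/q\<close> is integral and can be
    moved into \<open>L\<close>; the norm of a sum is then even if the norms of the summands are.\<close>
  define T where "T x y = h x y / of_rat q + h y x / of_rat q" for x y
  have T_add: "T (x + x') y = T x y + T x' y" "T x (y + y') = T x y + T x y'" for x x' y y'
    by (simp_all add: T_def form_add[OF h] add_divide_distrib)
  have T_zero: "T 0 y = 0" "T x 0 = 0" for x y
    by (simp_all add: T_def form_zero[OF h])
  have gen: "T (a *s u) (b *s v) \<in> even_integers" if "a \<in> I" "b \<in> I" "u \<in> L" "v \<in> L" for a b u v
  proof -
    define r where "r = a * cnj b / of_rat q"
    have "r *s u \<in> L"
      using that unfolding r_def by (intro V.submod_smul[OF L(1)] conj_scaled_mem[OF I(2)])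
    then have "h (r *s u) v + h v (r *s u) \<in> even_integers"
      using that by (intro even_lattice_trace[OF h L(2,1)])
    moreover have "cnj r = cnj a * b / of_rat q"
      unfolding r_def by (simp add: conj_divide_rat conj_mult)
    ultimately show ?thesis
      by (simp add: T_def form_scale[OF h] r_def mult_ac)
  qed
  \<comment> \<open>\<open>T\<close> is additive but not \<open>oo\<close>-linear in its arguments,
    hence \<open>prd_least_additive\<close>.\<close>
  have "V.prd I L \<subseteq> {y. T (a *s u) y \<in> even_integers}" if "a \<in> I" "u \<in> L" for a u
    using that by (intro V.prd_least_additive[OF smI])
      (auto simp: T_add T_zero gen intro: K.submod_add[OF submod_even_integers] K.submod_zero[OF submod_even_integers])
  then have "V.prd I L \<subseteq> {x. T x y \<in> even_integers}" if "y \<in> V.prd I L" for y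
    using that by (intro V.prd_least_additive[OF smI])
      (auto simp: T_add T_zero intro: K.submod_add[OF submod_even_integers] K.submod_zero[OF submod_even_integers])
  then have T: "T x y \<in> even_integers" if "x \<in> V.prd I L" "y \<in> V.prd I L" for x y
    using that by blast
  \<comment> \<open>Membership in the product is kept in the set, so that \<open>T\<close> controls
    the cross term of a sum.\<close>
  have "V.prd I L \<subseteq> {x \<in> V.prd I L. h x x / of_rat q \<in> even_integers}"
  proof (rule V.prd_least_additive[OF smI])
    show "0 \<in> {x \<in> V.prd I L. h x x / of_rat q \<in> even_integers}"
      by (simp add: form_zero[OF h] V.submod_zero V.submod_prd K.submod_zero submod_even_integers)
  next
    fix x y assume "x \<in> {x \<in> V.prd I L. h x x / of_rat q \<in> even_integers}"
      "y \<in> {x \<in> V.prd I L. h x x / of_rat q \<in> even_integers}"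
    then have xy: "x \<in> V.prd I L" "y \<in> V.prd I L" "h x x / of_rat q \<in> even_integers"
      "h y y / of_rat q \<in> even_integers" by auto
    then have "h x x / of_rat q + h y y / of_rat q + T x y \<in> even_integers"
      by (intro K.submod_add[OF submod_even_integers] T)
    then have "h (x + y) (x + y) / of_rat q \<in> even_integers"
      by (simp add: T_def form_add[OF h] add_divide_distrib algebra_simps)
    then show "x + y \<in> {x \<in> V.prd I L. h x x / of_rat q \<in> even_integers}"
      using xy by (simp add: V.submod_add V.submod_prd)
  next
    fix a u assume a: "a \<in> I" "u \<in> L"
    then have "a * cnj a / of_rat q * h u u \<in> even_integers"
      using L(2) by (intro K.submod_smul[OF submod_even_integers] conj_scaled_mem[OF I(2)])
        (auto simp: even_lattice_iff)
    then have "h (a *s u) (a *s u) / of_rat q \<in> even_integers"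
      by (simp add: form_scale[OF h] mult_ac)
    then show "a *s u \<in> {x \<in> V.prd I L. h x x / of_rat q \<in> even_integers}"
      using a by (simp add: V.prdI)
  qed
  then show ?thesis
    unfolding even_lattice_iff by blast
qed

section \<open>The rescaling bijection\<close>

lemma conj_scaled_conj_scaled: "q \<noteq> 0 \<Longrightarrow> conj_scaled (inverse q) (conj_scaled q I) = I"
proof -
  assume q: "q \<noteq> 0"
  have "conj_scaled (inverse q) (conj_scaled q I) = (\<lambda>a. cnj (cnj a / of_rat q) / of_rat (inverse q)) ` I"
    by (auto simp: conj_scaled_def)
  also have "\<dots> = I"
    using q by (simp add: conj_divide_rat of_rat_inverse)
  finally show ?thesis .
qed

definition unit_norm_pair :: "'k set \<Rightarrow> rat \<Rightarrow> bool" where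
  "unit_norm_pair I q \<longleftrightarrow> fractional_ideal I \<and> q > 0 \<and> K.prd I (conj_scaled q I) = oo"

text \<open>Scaling the inverse ideal by \<open>inverse q\<close> returns \<open>I\<close>, so the
  defining equation is the old one with its factors exchanged.\<close>

lemma unit_norm_pair_inverse:
  "unit_norm_pair I q \<Longrightarrow> unit_norm_pair (conj_scaled q I) (inverse q)"
  by (simp add: unit_norm_pair_def fractional_ideal_conj_scaled conj_scaled_conj_scaled prd_comm)

text \<open>The ideals multiply to \<open>oo\<close>, which fixes every submodule, and the two
  divisions of the form cancel.\<close>

lemma rescale_inverse:
  assumes "unit_norm_pair I q" "V.submod (snd P)"
  shows "rescale (conj_scaled q I) (inverse q) (rescale I q P) = P"
  using assms
  by (simp add: rescale_def unit_norm_pair_def of_rat_inverse V.prd_one prd_comm[of _ I] flip: V.prd_assoc)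

lemma rescale_unimodular_lattices:
  assumes I: "unit_norm_pair I q" and P: "P \<in> unimodular_lattices p C"
  shows "rescale I q P \<in> unimodular_lattices p (ideal_class I [^]\<^bsub>class_group\<^esub> CARD('n) \<otimes>\<^bsub>class_group\<^esub> C)"
proof -
  obtain h L where hL: "P = (h, L)" "hermitian_form h" "positive_definite h" "lattice_in_space L"
    "unimodular h L" "has_parity p h L" "has_steinitz_class L C"
    using P by (auto simp: unimodular_lattices_def)
  have I': "fractional_ideal I" "q > 0" "K.prd I (conj_scaled q I) = oo"
    using I by (auto simp: unit_norm_pair_def)
  let ?h = "\<lambda>x y. h x y / of_rat q"
  have sub: "V.submod L"
    by (rule lattice_in_space_submod[OF hL(4)])
  have even: "even_lattice ?h (V.prd I L) \<longleftrightarrow> even_lattice h L"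
  proof
    assume "even_lattice h L"
    then show "even_lattice ?h (V.prd I L)"
      by (rule even_lattice_rescale[OF hL(2) I'(1,3) sub])
  next
    \<comment> \<open>Odd lattices must stay odd; this direction is the previous one applied to the
      inverse pair.\<close>
    assume "even_lattice ?h (V.prd I L)"
    moreover have "fractional_ideal (conj_scaled q I)"
      "K.prd (conj_scaled q I) (conj_scaled (inverse q) (conj_scaled q I)) = oo"
      using unit_norm_pair_inverse[OF I] by (simp_all add: unit_norm_pair_def)
    ultimately have "even_lattice (\<lambda>x y. ?h x y / of_rat (inverse q)) (V.prd (conj_scaled q I) (V.prd I L))"
      by (intro even_lattice_rescale[OF hermitian_form_divide[OF hL(2)] _ _ V.submod_prd])
    then show "even_lattice h L"
      using rescale_inverse[OF I, of "(h, L)"] sub by (simp add: rescale_def)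
  qed
  have "has_parity p ?h (V.prd I L)"
    using hL(6) even by (cases p) auto
  then show ?thesis
    unfolding unimodular_lattices_def rescale_def hL(1) using hL I'
    by (simp add: hermitian_form_divide positive_definite_divide lattice_in_space_prd unimodular_rescale steinitz_prd)
qed

text \<open>Rescaling by an ideal in \<open>D\<close> and by its inverse are mutually inverse on the
  lattices counted, respect isometry, and shift the Steinitz class by opposite powers.\<close>

lemma partial_class_number_mult_pow:
  assumes A: "A \<in> carrier (class_group :: 'k set set monoid)" and D: "D \<in> carrier (class_group :: 'k set set monoid)"
  shows "partial_class_number TYPE('n) p (D [^]\<^bsub>class_group\<^esub> CARD('n) \<otimes>\<^bsub>class_group\<^esub> A) =
    partial_class_number TYPE('n) p A"
proof -
  obtain I where I: "fractional_ideal I" "D = ideal_class I"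
    using D by (auto simp: carrier_class_group)
  obtain q where q: "q > 0" "K.prd I (conj_scaled q I) = oo"
    using ideal_inverse[OF I(1)] by blast
  define J where "J = conj_scaled q I"
  have Iq: "unit_norm_pair I q"
    using I q by (simp add: unit_norm_pair_def)
  then have Jq: "unit_norm_pair J (inverse q)"
    unfolding J_def by (rule unit_norm_pair_inverse)
  let ?B = "D [^]\<^bsub>class_group\<^esub> CARD('n) \<otimes>\<^bsub>class_group\<^esub> A"
  have J: "fractional_ideal J"
    using Jq by (simp add: unit_norm_pair_def)
  then have "ideal_class J \<in> carrier class_group"
    by (auto simp: carrier_class_group)
  moreover have "ideal_class J \<otimes>\<^bsub>class_group\<^esub> D = \<one>\<^bsub>class_group\<^esub>"
  proof -
    have "ideal_class J \<otimes>\<^bsub>class_group\<^esub> D = ideal_class oo"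
      using q I(1) J ideal_class_mult[OF J I(1)] by (simp add: I(2) J_def prd_comm[of _ I])
    \<comment> \<open>\<open>oo\<close> is the empty power of \<open>I\<close>, so
      \<open>ideal_class_pow\<close> identifies its class.\<close>
    also have "\<dots> = ideal_class I [^]\<^bsub>class_group\<^esub> (0 :: nat)"
      using ideal_class_pow[OF I(1), of 0] by (simp add: ideal_group_def)
    finally show ?thesis by simp
  qed
  ultimately have JD: "ideal_class J \<in> carrier class_group" "ideal_class J \<otimes>\<^bsub>class_group\<^esub> D = \<one>\<^bsub>class_group\<^esub>"
    by auto
  have J': "ideal_class J [^]\<^bsub>class_group\<^esub> CARD('n) \<otimes>\<^bsub>class_group\<^esub> ?B = A"
  proof -
    have "ideal_class J [^]\<^bsub>class_group\<^esub> CARD('n) \<otimes>\<^bsub>class_group\<^esub> D [^]\<^bsub>class_group\<^esub> CARD('n) = \<one>\<^bsub>class_group\<^esub>"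
      using CG.nat_pow_distrib[OF JD(1) D, of "CARD('n)"] by (simp add: JD(2))
    then show ?thesis
      using A D JD(1) by (simp flip: CG.m_assoc)
  qed
  have sub: "V.submod (snd P)" if "P \<in> unimodular_lattices p C" for P C
    using that by (auto simp: unimodular_lattices_def lattice_in_space_submod)
  have "card ((unimodular_lattices p A :: (('k, 'n) form \<times> _) set) // lattice_isometry) =
    card ((unimodular_lattices p ?B :: (('k, 'n) form \<times> _) set) // lattice_isometry)"
  proof (rule card_quotient_eqI[of _ "rescale I q" _ _ "rescale J (inverse q)"])
    fix P :: "('k, 'n) form \<times> ('k^'n) set"
    show "rescale I q P \<in> unimodular_lattices p ?B" if "P \<in> unimodular_lattices p A"
      using rescale_unimodular_lattices[OF Iq that] by (simp add: I(2))
    show "rescale J (inverse q) P \<in> unimodular_lattices p A" if "P \<in> unimodular_lattices p ?B"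
      using rescale_unimodular_lattices[OF Jq that] by (simp only: J')
    show "rescale J (inverse q) (rescale I q P) = P" if "P \<in> unimodular_lattices p A"
      unfolding J_def by (rule rescale_inverse[OF Iq sub[OF that]])
    show "rescale I q (rescale J (inverse q) P) = P" if "P \<in> unimodular_lattices p ?B"
      using rescale_inverse[OF Jq sub[OF that]] q by (simp add: J_def conj_scaled_conj_scaled)
  qed (auto intro: rescale_isometry equiv_lattice_isometry)
  then show ?thesis
    by (simp add: partial_class_number_def)
qed

end

theorem theorem3p6:
  fixes p :: parity
  assumes "imaginary_quadratic_field TYPE('k::field_char_0)"
  shows "(gcd CARD('n::finite) (order (class_group :: 'k set set monoid)) = 1 \<longrightarrow>
           (\<forall>A \<in> carrier (class_group :: 'k set set monoid). \<forall>B \<in> carrier (class_group :: 'k set set monoid).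
              partial_class_number TYPE('n) p A = partial_class_number TYPE('n) p B)) \<and>
         (gcd CARD('n) (group_exponent (class_group :: 'k set set monoid)) \<le> 2 \<longrightarrow>
           (\<forall>A \<in> carrier (class_group :: 'k set set monoid). \<forall>B \<in> carrier (class_group :: 'k set set monoid).
              same_ideal_genus A B \<longrightarrow>
              partial_class_number TYPE('n) p A = partial_class_number TYPE('n) p B))"
proof -
  interpret hermitian_lattices "TYPE('k)" "TYPE('n)"
    by unfold_locales (rule assms)
  let ?G = "class_group :: 'k set set monoid"
  \<comment> \<open>For an infinite carrier \<open>order\<close> would be 0, and the claim would
    concern the empty power.\<close>
  have pow_order: "x [^]\<^bsub>?G\<^esub> order ?G = \<one>\<^bsub>?G\<^esub>" if "x \<in> carrier ?G" for x
    using that CG.power_order_eq_one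
    by (cases "finite (carrier ?G)") (simp_all add: order_def)
  \<comment> \<open>Common to both parts: \<open>k = 1\<close> with the group order, and
    \<open>k = 2\<close> with the exponent.\<close>
  have eq: "partial_class_number TYPE('n) p A = partial_class_number TYPE('n) p B"
    if AB: "A \<in> carrier ?G" "B \<in> carrier ?G" and C: "C \<in> carrier ?G" "A \<otimes>\<^bsub>?G\<^esub> inv\<^bsub>?G\<^esub> B = C [^]\<^bsub>?G\<^esub> k"
      and e: "\<And>x. x \<in> carrier ?G \<Longrightarrow> x [^]\<^bsub>?G\<^esub> e = \<one>\<^bsub>?G\<^esub>" and k: "gcd CARD('n) e dvd k"
    for A B C :: "'k set set" and e k :: nat
  proof -
    obtain D where D: "D \<in> carrier ?G" "D [^]\<^bsub>?G\<^esub> CARD('n) = C [^]\<^bsub>?G\<^esub> k"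
      using CG.nth_power_of_gcd_dvd[OF e _ k C(1)] by auto
    have "A = D [^]\<^bsub>?G\<^esub> CARD('n) \<otimes>\<^bsub>?G\<^esub> B"
      using AB by (simp add: D(2) CG.m_assoc flip: C(2))
    then show ?thesis
      using partial_class_number_mult_pow[OF AB(2) D(1)] by simp
  qed
  show ?thesis
  proof (intro conjI impI ballI)
    fix A B :: "'k set set"
    assume "gcd CARD('n) (order ?G) = 1" "A \<in> carrier ?G" "B \<in> carrier ?G"
    then show "partial_class_number TYPE('n) p A = partial_class_number TYPE('n) p B"
      by (intro eq[where C = "A \<otimes>\<^bsub>?G\<^esub> inv\<^bsub>?G\<^esub> B" and k = 1 and e = "order ?G"])
        (simp_all add: pow_order)
  next
    fix A B :: "'k set set"
    assume g: "gcd CARD('n) (group_exponent ?G) \<le> 2" and AB: "A \<in> carrier ?G" "B \<in> carrier ?G"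
      and "same_ideal_genus A B"
    then obtain C where C: "C \<in> carrier ?G" "A \<otimes>\<^bsub>?G\<^esub> inv\<^bsub>?G\<^esub> B = C [^]\<^bsub>?G\<^esub> (2 :: nat)"
      unfolding same_ideal_genus_def by blast
    \<comment> \<open>A positive gcd of at most 2 divides 2, so squares are
      \<open>CARD('n)\<close>-th powers.\<close>
    have "gcd CARD('n) (group_exponent ?G) \<noteq> 0"
      by simp
    with g have "gcd CARD('n) (group_exponent ?G) = 1 \<or> gcd CARD('n) (group_exponent ?G) = 2"
      by linarith
    then have "gcd CARD('n) (group_exponent ?G) dvd 2"
      by auto
    with AB C show "partial_class_number TYPE('n) p A = partial_class_number TYPE('n) p B"
      by (intro eq[where e = "group_exponent ?G"] CG.pow_group_exponent)
  qed
qed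

end
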